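(* Let $\alpha$, with $\mathrm{house}(\alpha)>1$, be a reciprocal algebraic integer such that $n=\mathrm{dyg}(\mathrm{house}(\alpha))\ge260$, with $\mathrm M(\alpha)<1.176280\ldots$ (Lehmer's number) and minimal polynomial not of the form $Q(X^r)$ with $r\ge2$ an integer and $Q\in\mathbb Z[X]$. The asymptotic expansion of the minorant $L_r(\alpha)$ of $\log\mathrm M_r(\alpha)$ is $$L_r(\alpha)=\log(\Lambda_r\mu_r)+\frac{\mathcal R}{\log n}+O\Bigl(\Bigl(\frac{\log\log n}{\log n}\Bigr)^2\Bigr),\qquad\text{with } |\mathcal R|<\frac{\arcsin(\kappa/2)}\pi,$$ and $\mathcal R$ depending upon $\mathrm{house}(\alpha)$ and $n$.
   Context: $\mathrm M$: Mahler measure; $\mathrm{house}(\alpha)$: maximum modulus of the conjugates of $\alpha$. Reciprocal: the minimal polynomial $P$ satisfies $P(X)=X^{\deg P}P(1/X)$. Lehmer's number: largest real root of $X^{10}+X^9-X^7-X^6-X^5-X^4-X^3+X+1$. For $n\ge2$, $G_n(z)=-1+z+z^n$, $\theta_n$ is its unique root in $(0,1)$, and $z_{1,n},\ldots,z_{\lfloor n/6\rfloor,n}$ are its roots with modulus $<1$ and positive imaginary part, ordered by increasing argument. For $1<\beta<\frac{1+\sqrt5}2$, $\mathrm{dyg}(\beta)$ is the unique integer $n\ge3$ with $\theta_n^{-1}\le\beta<\theta_{n-1}^{-1}$. With $T_\beta(x)=\{\beta x\}$ on $[0,1]$, $t_i=\lfloor\beta T_\beta^{i-1}(1)\rfloor$,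 $f_\beta(z)=-1+\sum_{i\ge1}t_iz^i$, $|z|<1$. The function $a\mapsto\frac{1-e^{-\pi/a}}{2e^{\pi/a}-1}$, $a>0$, attains its maximum $\kappa=0.171573\ldots$ at $a_{\max}=5.87433\ldots$. $J_n$ is the largest $j\ge1$ with $|-1+z_{j,n}|/|z_{j,n}|\le\kappa$. With $\beta=\mathrm{house}(\alpha)$ and $n=\mathrm{dyg}(\beta)$, $\omega_{j,n}$ ($1\le j\le J_n$) is the unique (simple) zero of $f_\beta$ in $\{|z-z_{j,n}|<\frac{\pi|z_{j,n}|}{n a_{\max}}\}$, and $\mathrm M_r(\alpha):=\beta\prod_{j=1}^{J_n}|\omega_{j,n}|^{-2}$. The minorant of $\log\mathrm M_r(\alpha)$ is $$L_r(\alpha)=\log\beta-2\sum_{j=1}^{J_n}\log|z_{j,n}|-2\sum_{j=1}^{\lfloor v_n\rfloor}\log\Bigl(1+\frac\pi{n a_{\max}}\Bigr)-2\sum_{j=\lceil v_n\rceil}^{J_n}\log\Bigl(1+\frac\pi{n a_{j,n}}\Bigr),$$ where $a_{J_n,n}=a_{\max}$ and, for $\lceil v_n\rceil\le j<J_n$, $\frac\pi{a_{j,n}}=D+\frac2nB_{j,n}^{-1}\bigl(\frac{-3+e^{-D}+2e^D}{4-e^{-D}-2e^D}\bigr)\bigl(\frac{\log\log n}{\log n}\bigr)^2$ with $D=\log\bigl[\frac{1+B_{j,n}-\sqrt{1-6B_{j,n}+B_{j,n}^2}}{4B_{j,n}}\bigr]$ and $B_{j,n}=2\sin(\frac{\pi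 j}n)\bigl(1-\frac1n\log(2\sin(\frac{\pi j}n))\bigr)$. Here $\epsilon\in(0,1)$ is fixed and small enough, and $(u_n),(v_n)$ are fixed strictly increasing real sequences with, for $n\ge18$, $\lfloor n/6\rfloor>v_n>\log n>u_n>\sqrt{(\log n)(\log\log n)}$, $v_n/n\to0$, $\sqrt{(\log n)(\log\log n)}/u_n\to0$, $u_n/\log n\to0$, $\log n/v_n\to0$, $v_n-u_n=O((\log n)^{1+\epsilon})$ with constant $1$, and (for $n\ge195$) $2\pi v_n/n<2\arcsin(\kappa/2)$. Finally $$\Lambda_r\mu_r=\exp\Bigl(\frac{-1}{\pi}\int_0^{2\arcsin(\kappa/2)}\log\Bigl[\frac{1+2\sin(\frac x2)-\sqrt{1-12\sin(\frac x2)+4(\sin(\frac x2))^2}}{4}\Bigr]dx\Bigr)=1.15411\ldots$$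
   Formalization: The condition v_n < ⌊n/6⌋ is required only for n ≥ 24 instead of n ≥ 18, because with v_n > log n it is contradictory at n = 21, 22, 23 (⌊n/6⌋ = 3 < log 21). *)

theory Defs
  imports
    "HOL-Analysis.Analysis"
    "Berlekamp_Zassenhaus.Mahler_Measure"
begin

text \<open>Irreducibility in \<open>\<int>[X]\<close> forces content 1, so for an algebraic integer the following
  polynomial is the monic minimal polynomial over \<open>\<rat>\<close>.\<close>

definition min_int_poly :: "complex \<Rightarrow> int poly" where
  "min_int_poly \<alpha> =
     (THE p. irreducible p \<and> lead_coeff p > 0 \<and> poly (map_poly of_int p) \<alpha> = 0)"

definition conjugates :: "complex \<Rightarrow> complex set" where
  "conjugates \<alpha> = {z. poly (map_poly of_int (min_int_poly \<alpha>)) z = 0}"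

definition house :: "complex \<Rightarrow> real" where
  "house \<alpha> = Max (cmod ` conjugates \<alpha>)"

text \<open>The operation \<open>reflect_poly\<close> sends \<open>P\<close> to \<open>X ^ degree P * P(1/X)\<close>.\<close>

definition reciprocal :: "complex \<Rightarrow> bool" where
  "reciprocal \<alpha> \<longleftrightarrow> reflect_poly (min_int_poly \<alpha>) = min_int_poly \<alpha>"

definition lehmer_number :: real where
  "lehmer_number = Max {x. poly [:1, 1, 0, -1, -1, -1, -1, -1, 0, 1, 1:] x = 0}"

definition Gtri :: "nat \<Rightarrow> 'a::comm_ring_1 \<Rightarrow> 'a" where
  "Gtri n z = -1 + z + z ^ n"

definition theta :: "nat \<Rightarrow> real" where
  "theta n = (THE x. 0 < x \<and> x < 1 \<and> Gtri n x = 0)"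

text \<open>The list is 0-based while the roots \<open>z\<^sub>j\<^sub>,\<^sub>n\<close> are numbered from \<open>j = 1\<close> to \<open>n div 6\<close>.\<close>

definition zroot :: "nat \<Rightarrow> nat \<Rightarrow> complex" where
  "zroot n j =
     sorted_key_list_of_set Arg {z. Gtri n z = 0 \<and> cmod z < 1 \<and> Im z > 0} ! (j - 1)"

definition dyg :: "real \<Rightarrow> nat" where
  "dyg \<beta> = (THE n. n \<ge> 3 \<and> inverse (theta n) \<le> \<beta> \<and> \<beta> < inverse (theta (n - 1)))"

definition kappa_fun :: "real \<Rightarrow> real" where
  "kappa_fun a = (1 - exp (- pi / a)) / (2 * exp (pi / a) - 1)"

definition a_max :: real where
  "a_max = (ARG_MAX kappa_fun a. a > 0)"

definition kappa :: real where
  "kappa = kappa_fun a_max"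

definition J_max :: "nat \<Rightarrow> nat" where
  "J_max n = Max {j \<in> {1..n div 6}. cmod (-1 + zroot n j) / cmod (zroot n j) \<le> kappa}"

definition B_coef :: "nat \<Rightarrow> nat \<Rightarrow> real" where
  "B_coef n j = 2 * sin (pi * real j / real n) * (1 - 1 / real n * ln (2 * sin (pi * real j / real n)))"

definition D_coef :: "nat \<Rightarrow> nat \<Rightarrow> real" where
  "D_coef n j = ln ((1 + B_coef n j - sqrt (1 - 6 * B_coef n j + (B_coef n j)\<^sup>2)) / (4 * B_coef n j))"

definition a_coef :: "nat \<Rightarrow> nat \<Rightarrow> real" where
  "a_coef n j =
     (if j = J_max n then a_max
      else pi / (D_coef n j + 2 / real n * inverse (B_coef n j)
                   * ((-3 + exp (- D_coef n j) + 2 * exp (D_coef n j)) / (4 - exp (- D_coef n j) - 2 * exp (D_coef n j)))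
                   * (ln (ln (real n)) / ln (real n))\<^sup>2))"

definition L_r :: "(nat \<Rightarrow> real) \<Rightarrow> complex \<Rightarrow> real" where
  "L_r v \<alpha> =
     (let \<beta> = house \<alpha>; n = dyg \<beta> in
        ln \<beta>
        - 2 * (\<Sum>j = 1..J_max n. ln (cmod (zroot n j)))
        - 2 * (\<Sum>j = 1..nat \<lfloor>v n\<rfloor>. ln (1 + pi / (real n * a_max)))
        - 2 * (\<Sum>j = nat \<lceil>v n\<rceil>..J_max n. ln (1 + pi / (real n * a_coef n j))))"

text \<open>The bound \<open>v n < \<lfloor>n/6\<rfloor>\<close> is required from \<open>n = 24\<close> on: together with \<open>ln n < v n\<close> it is
  contradictory for \<open>n = 21, 22, 23\<close>, since \<open>\<lfloor>n/6\<rfloor> = 3 < ln 21\<close> there.\<close>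

definition admissible :: "real \<Rightarrow> (nat \<Rightarrow> real) \<Rightarrow> (nat \<Rightarrow> real) \<Rightarrow> bool" where
  "admissible \<epsilon> u v \<longleftrightarrow>
     strict_mono u \<and> strict_mono v \<and>
     (\<forall>n\<ge>24. v n < real_of_int \<lfloor>real n / 6\<rfloor>) \<and>
     (\<forall>n\<ge>18. ln (real n) < v n \<and> u n < ln (real n) \<and> sqrt (ln (real n) * ln (ln (real n))) < u n) \<and>
     (\<lambda>n. v n / real n) \<longlonglongrightarrow> 0 \<and>
     (\<lambda>n. sqrt (ln (real n) * ln (ln (real n))) / u n) \<longlonglongrightarrow> 0 \<and>
     (\<lambda>n. u n / ln (real n)) \<longlonglongrightarrow> 0 \<and>
     (\<lambda>n. ln (real n) / v n) \<longlonglongrightarrow> 0 \<and>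
     (\<forall>n\<ge>18. v n - u n \<le> ln (real n) powr (1 + \<epsilon>)) \<and>
     (\<forall>n\<ge>195. 2 * pi * v n / real n < 2 * arcsin (kappa / 2))"

definition Lambda_mu_r :: real where
  "Lambda_mu_r =
     exp (- 1 / pi * integral {0..2 * arcsin (kappa / 2)}
       (\<lambda>x. ln ((1 + 2 * sin (x / 2) - sqrt (1 - 12 * sin (x / 2) + 4 * (sin (x / 2))\<^sup>2)) / 4)))"

end

theory Submission
  imports Defs "HOL-Real_Asymp.Real_Asymp"
begin

text \<open>
  The roots of \<open>z\<^sup>n = 1 - z\<close> in the upper half of the unit disc are localised by comparing arguments:
  \<open>n Arg z\<close> lies within \<open>\<pi>/2\<close> below a multiple \<open>2 \<pi> j\<close>, and for \<open>j \<le> n/6\<close> exactly one root belongs to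
  \<open>j\<close>. Hence \<open>n log |z\<^sub>j|\<close> is close to \<open>log (2 sin (\<pi> j / n))\<close>, and the two sums over \<open>j \<le> J\<^sub>n\<close> in the minorant
  form a Riemann sum of step \<open>2 \<pi> / n\<close> for the integral defining \<open>\<Lambda>\<^sub>r \<mu>\<^sub>r\<close>. The discriminant \<open>1 - 6 B + B\<^sup>2\<close>
  vanishes at \<open>B = \<kappa>\<close>, but for \<open>j < J\<^sub>n\<close> the value \<open>B\<^sub>j\<close> stays below \<open>\<kappa>\<close> by at least \<open>1/n\<close>, so the
  perturbation in \<open>\<pi> / a\<^sub>j\<close> costs a factor of at most \<open>\<surd>n\<close>. The total error is \<open>O(log n / \<surd>n)\<close>, which is absorbed
  by \<open>(log log n / log n)\<^sup>2\<close>, so that \<open>\<R> = 0\<close> is a valid choice.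
\<close>

subsection \<open>The house and the Mahler measure\<close>

text \<open>The minorant is the logarithm of the house plus a quantity \<open>K_r v n\<close> that
  depends on the number only through n. This is why one constant can serve all numbers at once:
  below the asymptotic threshold only finitely many n remain. Lehmer's number lies below the golden
  ratio, so the house determines n, and log house is O(1 / sqrt n).

  The delicate point is the end of the sum, where the discriminant degenerates. The two-sided
  estimate of |1 - z_j| has error (log n + 2) / n, too coarse to keep the nodes below kappa.
  Membership in the set defining J_n is therefore exploited through the one-sided inequality |1 - z|
  / |z| >= 2 sin (Arg z / 2). With Arg z_j >= (2 pi j - pi / 2) / n it loses only pi / (4 n) in the
  half-angle, less than the spacing pi / n, so every j < J_n keeps a margin of order 1 / n.

  At the other end the integrand has a logarithmic singularity, tamed by the majorant 3 / sqrt x.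
  The cut at v_n costs O((log n)^2 / n), because v_n <= 2 (log n)^2 eventually.\<close>

lemma irreducible_int_poly_root_dvd:
  fixes p q :: "int poly" and \<alpha> :: complex
  assumes p: "irreducible p" "poly (map_poly of_int p) \<alpha> = 0"
    and q: "irreducible q" "poly (map_poly of_int q) \<alpha> = 0"
  shows "p dvd q"
proof -
  define P where "P = (\<lambda>f :: int poly. f \<noteq> 0 \<and> poly (map_poly of_int f) \<alpha> = 0)"
  have Pp: "P p" "P q" using assms by (auto simp: P_def)
  \<comment> \<open>Pseudo-division by an annihilator of least degree stays inside the integers: it
    shows that \<open>m\<close> divides a nonzero integer multiple of every annihilator.\<close>
  obtain m where m: "P m" "\<And>f. P f \<Longrightarrow> degree m \<le> degree f"
    using ex_has_least_nat[of P p degree] Pp by blast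
  have *: "\<exists>a. a \<noteq> 0 \<and> m dvd Polynomial.smult a f" if "P f" for f
  proof -
    have m0: "m \<noteq> 0" using m by (auto simp: P_def)
    obtain a g where ag: "a \<noteq> 0" "Polynomial.smult a f = m * g + pseudo_mod f m"
      using pseudo_mod(1)[OF m0, of f] by blast
    have "poly (map_poly of_int (Polynomial.smult a f)) \<alpha> = 0"
      using that by (simp add: P_def of_int_hom.map_poly_hom_smult)
    hence "poly (map_poly of_int (pseudo_mod f m)) \<alpha> = 0"
      using m(1) unfolding ag(2) by (simp add: P_def of_int_poly_hom.hom_add of_int_poly_hom.hom_mult)
    hence "pseudo_mod f m = 0"
      using pseudo_mod(2)[OF m0, of f] m(2)[of "pseudo_mod f m"] by (fastforce simp: P_def)
    thus ?thesis using ag by auto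
  qed
  have deg: "degree f > 0" if "P f" for f
  proof (rule ccontr)
    assume "\<not> degree f > 0"
    then obtain c where "f = [:c:]" by (auto elim: degree_eq_zeroE)
    thus False using that by (auto simp: P_def of_int_hom.map_poly_pCons_hom)
  qed
  have prime: "prime_elem f" if "irreducible f" for f :: "int poly"
    using that irreducible_imp_prime_elem_gcd by blast
  obtain a where a: "a \<noteq> 0" "m dvd Polynomial.smult a p" using * Pp by blast
  obtain b where b: "b \<noteq> 0" "m dvd Polynomial.smult b q" using * Pp by blast
  obtain g where g: "Polynomial.smult a p = m * g" using a by blast
  have "p dvd m * g" unfolding g[symmetric] by (simp add: dvd_smult)
  \<comment> \<open>The cofactor \<open>g\<close> has smaller degree than \<open>p\<close>, because
    \<open>m\<close> is not constant; primality of \<open>p\<close> then forces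
    \<open>p dvd m\<close>.\<close>
  moreover have "\<not> p dvd g"
  proof
    assume "p dvd g"
    have g0: "g \<noteq> 0" using g a Pp by (auto simp: P_def)
    have "degree p = degree m + degree g"
      using arg_cong[OF g, of degree] a m(1) g0 by (auto simp: degree_mult_eq P_def)
    with deg[OF m(1)] dvd_imp_degree_le[OF \<open>p dvd g\<close> g0] show False by simp
  qed
  ultimately have "p dvd m" using prime[OF p(1)] by (simp add: prime_elem_dvd_mult_iff)
  hence "p dvd Polynomial.smult b q" using b dvd_trans by blast
  hence "p dvd [:b:] * q" by simp
  moreover have "\<not> p dvd [:b:]"
    using deg[OF Pp(1)] dvd_imp_degree_le[of p "[:b:]"] b by auto
  ultimately show ?thesis using prime[OF p(1)] by (metis prime_elem_dvd_mult_iff)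
qed

text \<open>Justifies the \<open>THE\<close> in \<open>min_int_poly\<close>. Existence: some prime
  factor of a monic annihilator vanishes at the number. Uniqueness: two candidates divide each
  other, hence differ by a sign, which the positive leading coefficient fixes.\<close>

lemma ex1_irreducible_int_poly_root:
  assumes "algebraic_int (\<alpha> :: complex)"
  shows "\<exists>!p :: int poly. irreducible p \<and> lead_coeff p > 0 \<and> poly (map_poly of_int p) \<alpha> = 0"
proof -
  obtain q :: "int poly" where q: "poly (map_poly of_int q) \<alpha> = 0" "lead_coeff q = 1"
    using assms by (auto simp: algebraic_int_altdef_ipoly)
  have q0: "q \<noteq> 0" using q by auto
  have "\<exists>p. irreducible p \<and> poly (map_poly of_int p) \<alpha> = 0"
    using q(1) q0
  proof (induction q rule: prime_divisors_induct)
    case zero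
    then show ?case by simp
  next
    case (unit x)
    then obtain c where "x = [:c:]" by (auto elim!: is_unit_polyE)
    then show ?case using unit by simp
  next
    case (factor p x)
    have "poly (map_poly of_int p) \<alpha> = 0 \<or> poly (map_poly of_int x) \<alpha> = 0"
      using factor.prems by (simp add: of_int_poly_hom.hom_mult)
    then show ?case using factor prime_elem_imp_irreducible[of p] by (auto simp: prime_def)
  qed
  then obtain p :: "int poly" where p: "irreducible p" "poly (map_poly of_int p) \<alpha> = 0" by blast
  define r where "r = (if lead_coeff p > 0 then p else -p)"
  have "lead_coeff p \<noteq> 0" using p by auto
  hence r: "irreducible r \<and> lead_coeff r > 0 \<and> poly (map_poly of_int r) \<alpha> = 0"
    using p by (auto simp: r_def of_int_poly_hom.hom_uminus)
  show ?thesis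
  proof (rule ex1I[of _ r], rule r)
    fix s :: "int poly"
    assume s: "irreducible s \<and> lead_coeff s > 0 \<and> poly (map_poly of_int s) \<alpha> = 0"
    have "s dvd r" "r dvd s" using r s irreducible_int_poly_root_dvd by blast+
    then obtain u w where u: "r = s * u" "s = r * w" unfolding dvd_def by blast
    have "r \<noteq> 0" using r by auto
    hence "u * w = 1" using u by (metis mult.assoc mult_cancel_left mult.right_neutral)
    hence "is_unit u" by (metis dvdI)
    then obtain c where c: "u = [:c:]" "is_unit c" by (auto elim!: is_unit_polyE)
    hence "c = 1 \<or> c = -1" by (auto simp: zdvd1_eq)
    moreover have "lead_coeff r = lead_coeff s * c" unfolding u(1) c(1) lead_coeff_mult by simp
    hence "c \<noteq> -1" using r s by auto
    ultimately show "s = r" using u c by (simp add: one_pCons[symmetric])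
  qed
qed

lemma min_int_poly_props:
  assumes "algebraic_int \<alpha>"
  shows "irreducible (min_int_poly \<alpha>)" "poly (map_poly of_int (min_int_poly \<alpha>)) \<alpha> = 0"
  using theI'[OF ex1_irreducible_int_poly_root[OF assms]] unfolding min_int_poly_def by blast+

text \<open>The house is the modulus of some root z. After splitting off X - z, the cofactor still
  has a leading coefficient of modulus at least 1, so its Mahler measure is at least 1.\<close>

lemma house_le_mahler_measure:
  assumes "algebraic_int \<alpha>" "house \<alpha> > 1"
  shows "house \<alpha> \<le> mahler_measure (min_int_poly \<alpha>)"
proof -
  define p where "p = min_int_poly \<alpha>"
  define P where "P = map_poly complex_of_int p"
  have p: "irreducible p" "poly P \<alpha> = 0" using min_int_poly_props[OF assms(1)] by (auto simp: p_def P_def)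
  have p0: "p \<noteq> 0" using p by auto
  have P0: "P \<noteq> 0" using p0 by (simp add: P_def)
  have conj: "conjugates \<alpha> = {z. poly P z = 0}" by (simp add: conjugates_def p_def P_def)
  have "house \<alpha> \<in> cmod ` conjugates \<alpha>"
    unfolding house_def using p(2) poly_roots_finite[OF P0] by (intro Max_in) (auto simp: conj)
  then obtain z where z: "poly P z = 0" "house \<alpha> = cmod z" by (auto simp: conj)
  obtain Q where Q: "P = [:-z, 1:] * Q" using z(1) by (auto simp: poly_eq_0_iff_dvd)
  have Q0: "Q \<noteq> 0" using P0 Q by auto
  have "lead_coeff Q = lead_coeff P" unfolding Q by (simp only: lead_coeff_mult) simp
  moreover have "1 \<le> \<bar>lead_coeff p\<bar>" using p0 leading_coeff_0_iff[of p] by linarith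
  ultimately have lQ: "cmod (lead_coeff Q) \<ge> 1" by (simp add: P_def)
  have "1 * 1 \<le> cmod (lead_coeff Q) * mahler_measure_monic Q"
    by (intro mult_mono lQ mahler_measure_monic_ge_1) auto
  hence "mahler_measure_poly Q \<ge> 1" by (simp add: mahler_measure_poly_via_monic)
  hence "mahler_measure_poly P \<ge> max 1 (cmod z)"
    unfolding Q measure_eq_prod mahler_measure_factor by (simp add: mult_le_cancel_left1)
  thus ?thesis using z by (simp add: mahler_measure_def P_def p_def)
qed

text \<open>The value 3/2 is a convenient one below the golden ratio
  \<open>inverse (theta 2)\<close>, the upper end of the range on which \<open>dyg\<close> is
  defined.\<close>

lemma lehmer_number_less: "lehmer_number < 3 / 2"
proof -
  define p :: "real poly" where "p = [:1, 1, 0, -1, -1, -1, -1, -1, 0, 1, 1:]"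
  have fin: "finite {x. poly p x = 0}" by (rule poly_roots_finite) (simp add: p_def)
  have "\<exists>x\<ge>1. x \<le> 2 \<and> poly p x = 0"
    by (rule IVT') (auto simp: p_def intro!: continuous_intros)
  hence ne: "{x. poly p x = 0} \<noteq> {}" by blast
  have pos: "poly p x > 0" if "x \<ge> 3/2" for x
  proof -
    \<comment> \<open>Horner evaluation preserves the bound 2: all coefficients are at least -1, and
      -1 + (3/2) * 2 = 2.\<close>
    have step: "2 \<le> a + x * h" if "-1 \<le> a" "2 \<le> h" for a h
      using mult_mono[OF \<open>x \<ge> 3/2\<close> that(2)] \<open>x \<ge> 3/2\<close> that by simp
    have base: "2 \<le> 1 + x * 1" using that by simp
    have "poly p x \<ge> 2" unfolding p_def poly_pCons poly_0 mult_zero_right add_0_right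
      by (rule base | (rule step, simp))+
    thus ?thesis by simp
  qed
  have "Max {x. poly p x = 0} < 3/2"
    using fin ne pos by (subst Max_less_iff) (force simp: not_le[symmetric])+
  thus ?thesis by (simp add: lehmer_number_def p_def)
qed

subsection \<open>The dynamical degree\<close>

lemma Gtri_strict_mono:
  assumes "0 \<le> x" "x < (y::real)"
  shows "Gtri n x < Gtri n y"
proof -
  have "x ^ n \<le> y ^ n" using assms by (intro power_mono) auto
  thus ?thesis using assms by (simp add: Gtri_def)
qed

lemma theta_props:
  assumes "n \<ge> 2"
  shows "0 < theta n" "theta n < 1" "theta n ^ n = 1 - theta n"
proof -
  have "\<exists>x\<ge>0. x \<le> 1 \<and> Gtri n x = (0::real)"
    using assms by (intro IVT') (auto simp: Gtri_def power_0_left intro!: continuous_intros)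
  then obtain x :: real where x: "0 \<le> x" "x \<le> 1" "Gtri n x = 0" by blast
  have "x \<noteq> 0" "x \<noteq> 1" using x(3) assms by (auto simp: Gtri_def power_0_left)
  hence x': "0 < x \<and> x < 1 \<and> Gtri n x = 0" using x by auto
  have "theta n = x"
    unfolding theta_def
  proof (rule the_equality, rule x')
    fix y :: real assume "0 < y \<and> y < 1 \<and> Gtri n y = 0"
    thus "y = x" using Gtri_strict_mono[of x y n] Gtri_strict_mono[of y x n] x'
      by (cases x y rule: linorder_cases) auto
  qed
  thus "0 < theta n" "theta n < 1" "theta n ^ n = 1 - theta n"
    using x' by (auto simp: Gtri_def)
qed

lemma theta_strict_mono:
  assumes "2 \<le> m" "m < n"
  shows "theta m < theta n"
proof (rule ccontr)
  assume "\<not> theta m < theta n"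
  hence "theta n \<le> theta m" by simp
  note m = theta_props[OF assms(1)]
  note n = theta_props[of n]
  have "theta n ^ n < theta n ^ m"
    using assms n by (intro power_strict_decreasing) auto
  also have "\<dots> \<le> theta m ^ m" using n assms \<open>theta n \<le> theta m\<close> by (intro power_mono) auto
  finally show False using m n assms \<open>theta n \<le> theta m\<close> by auto
qed

text \<open>If d = 1 - theta n were at least 1 / sqrt n, then d = (1 - d)^n <= exp (-n d) <= exp
  (-sqrt n) < 1 / sqrt n. This crude decay already beats every power of 1 / log n.\<close>

lemma theta_lower:
  assumes "n \<ge> 2"
  shows "1 - theta n < 1 / sqrt n"
proof (rule ccontr)
  define d where "d = 1 - theta n"
  assume "\<not> 1 - theta n < 1 / sqrt n"
  hence d: "d \<ge> 1 / sqrt n" by (simp add: d_def)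
  note t = theta_props[OF assms]
  have s: "sqrt n > 0" using assms by simp
  have "d = (1 - d) ^ n" using t by (simp add: d_def)
  also have "\<dots> \<le> exp (-d) ^ n"
    using t exp_ge_add_one_self[of "-d"] by (intro power_mono) (auto simp: d_def)
  also have "\<dots> = exp (- (n * d))" by (simp add: exp_of_nat_mult[symmetric])
  also have "\<dots> \<le> exp (- sqrt n)"
  proof -
    have "sqrt n = n * (1 / sqrt n)" using s by (simp add: field_simps)
    also have "\<dots> \<le> n * d" using d by (intro mult_left_mono) auto
    finally show ?thesis by simp
  qed
  also have "\<dots> < 1 / sqrt n"
  proof -
    have "sqrt n < exp (sqrt n)" using exp_ge_add_one_self[of "sqrt n"] by linarith
    thus ?thesis using s by (simp add: exp_minus field_simps)
  qed
  finally show False using d by simp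
qed

text \<open>The intervals from \<open>inverse (theta n)\<close> to
  \<open>inverse (theta (n - 1))\<close> are disjoint, and their ends decrease to 1. The least n
  with \<open>inverse (theta n)\<close> at most beta is therefore the only candidate.\<close>

lemma dyg_bounds:
  assumes "1 < \<beta>" "\<beta> < 3/2"
  shows "dyg \<beta> \<ge> 3" "\<beta> < inverse (theta (dyg \<beta> - 1))"
proof -
  define P where "P = (\<lambda>n. n \<ge> 3 \<and> inverse (theta n) \<le> \<beta> \<and> \<beta> < inverse (theta (n - 1)))"
  define A where "A = (\<lambda>n. n \<ge> 2 \<and> inverse (theta n) \<le> \<beta>)"
  have "\<exists>n. A n"
  proof -
    have "(\<lambda>n. 1 - 1 / sqrt (real n)) \<longlonglongrightarrow> 1" by real_asymp
    moreover have "1 / \<beta> < 1" using assms by simp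
    ultimately have "\<forall>\<^sub>F n in sequentially. 1 / \<beta> < 1 - 1 / sqrt (real n)"
      by (rule order_tendstoD)
    hence "\<forall>\<^sub>F n in sequentially. 1 / \<beta> < 1 - 1 / sqrt (real n) \<and> n \<ge> 2"
      using eventually_ge_at_top by (rule eventually_conj)
    then obtain n where n: "1 / \<beta> < 1 - 1 / sqrt (real n)" "n \<ge> 2"
      by (metis (mono_tags, lifting) eventually_at_top_linorder order_refl)
    have "1 / \<beta> < theta n" using theta_lower[OF n(2)] n(1) by simp
    hence "inverse (theta n) \<le> \<beta>" using assms theta_props[OF n(2)] by (simp add: field_simps)
    thus ?thesis using n by (auto simp: A_def)
  qed
  hence L: "A (LEAST n. A n)" by (rule LeastI_ex)
  define N where "N = (LEAST n. A n)"
  \<comment> \<open>Rules out the value 2 for the least index, so that it is at least 3 as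
    \<open>dyg\<close> demands.\<close>
  have "theta 2 < 2/3"
  proof (rule ccontr)
    assume "\<not> theta 2 < 2/3"
    hence "theta 2 ^ 2 \<ge> (2/3)^2" by (intro power_mono) auto
    thus False using theta_props[of 2] \<open>\<not> theta 2 < 2/3\<close> by (simp add: power2_eq_square)
  qed
  hence "inverse (theta 2) > 3/2" using theta_props[of 2] by (simp add: field_simps)
  hence "\<not> A 2" using assms by (simp add: A_def)
  hence "N \<noteq> 2" using L by (auto simp: N_def)
  hence N: "N \<ge> 3" "A N" using L unfolding N_def A_def by auto
  have "\<not> A (N - 1)" using not_less_Least[of "N - 1" A] N by (auto simp: N_def)
  hence PN: "P N" using N by (auto simp: A_def P_def)
  have lt: False if "P m" "P n" "m < n" for m n
  proof -
    have "theta m \<le> theta (n - 1)"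
      using theta_strict_mono[of m "n - 1"] that by (cases "m = n - 1") (fastforce simp: P_def)+
    moreover have "theta m > 0" using that theta_props[of m] by (auto simp: P_def)
    ultimately have "inverse (theta (n - 1)) \<le> inverse (theta m)" by simp
    thus False using that by (auto simp: P_def)
  qed
  have "dyg \<beta> = N"
    unfolding dyg_def using PN lt
    by (intro the_equality) (auto simp: P_def intro: linorder_neqE_nat)
  thus "dyg \<beta> \<ge> 3" "\<beta> < inverse (theta (dyg \<beta> - 1))" using PN by (auto simp: P_def)
qed

text \<open>log beta <= beta - 1 < (1 - t) / t with t = \<open>theta (n - 1)\<close>; from n = 5 on,
  t >= 1/2, and the division costs at most a factor 2.\<close>

lemma ln_house_bound:
  assumes "1 < \<beta>" "\<beta> < 3/2" "n = dyg \<beta>" "n \<ge> 5"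
  shows "0 \<le> ln \<beta>" "ln \<beta> \<le> 2 / sqrt (real (n - 1))"
proof -
  show "0 \<le> ln \<beta>" using assms by simp
  define t where "t = theta (n - 1)"
  have t: "0 < t" "t < 1" "1 - t < 1 / sqrt (real (n - 1))"
    using theta_props[of "n - 1"] theta_lower[of "n - 1"] assms(4) by (auto simp: t_def)
  have "sqrt (real (n - 1)) \<ge> 2" using assms(4) by (intro real_le_rsqrt) auto
  hence "1 / sqrt (real (n - 1)) \<le> 1 / 2" using assms(4) by (intro divide_left_mono) auto
  hence t2: "t \<ge> 1/2" using t by linarith
  have "ln \<beta> \<le> \<beta> - 1" using assms by (intro ln_le_minus_one) auto
  also have "\<beta> < inverse t" using dyg_bounds[OF assms(1,2)] assms(3) by (simp add: t_def)
  also have "inverse t - 1 = (1 - t) / t" using t by (simp add: field_simps)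
  also have "\<dots> \<le> (1 - t) / (1/2)" using t t2 by (intro divide_left_mono) auto
  also have "\<dots> \<le> 2 / sqrt (real (n - 1))" using t by simp
  finally show "ln \<beta> \<le> 2 / sqrt (real (n - 1))" by simp
qed

subsection \<open>The constant \<open>\<kappa>\<close>\<close>

text \<open>In y = exp (pi / a) the function is (y - 1) / (y (2 y - 1)). Completing the square at
  the critical point shows that it is 3 - 2 sqrt 2 minus a nonnegative term, so this is the
  maximum.\<close>

lemma a_max_kappa: "a_max > 0" "kappa = 3 - 2 * sqrt 2"
proof -
  \<comment> \<open>The root greater than 1 of 2 y^2 - 4 y + 1, the numerator of minus the
    derivative.\<close>
  define y0 :: real where "y0 = 1 + sqrt 2 / 2"
  define a0 where "a0 = pi / ln y0"
  have y0: "y0 > 1" by (simp add: y0_def)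
  have a0: "a0 > 0" "exp (pi / a0) = y0" using y0 by (auto simp: a0_def)
  have kf: "kappa_fun a = (3 - 2 * sqrt 2) - 2 * (3 - 2 * sqrt 2) * (y - y0)\<^sup>2 / (y * (2 * y - 1))"
    if "a > 0" "y = exp (pi / a)" for a y
  proof -
    have y: "y > 1" using that by simp
    have [simp]: "sqrt 2 * (sqrt 2 * z) = 2 * z" for z :: real
      by (simp add: mult.assoc[symmetric])
    have "kappa_fun a = (1 - 1 / y) / (2 * y - 1)"
      using that by (simp add: kappa_fun_def exp_minus divide_simps)
    also have "\<dots> = (y - 1) / (y * (2 * y - 1))" using y by (simp add: field_simps)
    also have "y - 1 = (3 - 2 * sqrt 2) * (y * (2 * y - 1)) - 2 * (3 - 2 * sqrt 2) * (y - y0)\<^sup>2"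
      by (simp add: y0_def power2_eq_square algebra_simps)
    finally show ?thesis using y by (simp add: diff_divide_distrib)
  qed
  have "sqrt 2 < 3/2" by (rule real_less_lsqrt) (auto simp: power2_eq_square)
  hence k: "3 - 2 * sqrt 2 > 0" by simp
  have le: "kappa_fun a \<le> 3 - 2 * sqrt 2" if "a > 0" for a
  proof -
    have "exp (pi / a) > 1" using that by simp
    hence "exp (pi / a) * (2 * exp (pi / a) - 1) > 0" by (intro mult_pos_pos) linarith+
    hence "2 * (3 - 2 * sqrt 2) * (exp (pi / a) - y0)\<^sup>2 / (exp (pi / a) * (2 * exp (pi / a) - 1)) \<ge> 0"
      using k by (intro divide_nonneg_pos mult_nonneg_nonneg) auto
    thus ?thesis using kf[OF that refl] by linarith
  qed
  have eq: "kappa_fun a0 = 3 - 2 * sqrt 2" using kf[OF a0(1) a0(2)[symmetric]] by simp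
  have "is_arg_max kappa_fun (\<lambda>a. a > 0) a0"
    using le eq a0 by (auto simp: is_arg_max_linorder)
  hence m: "is_arg_max kappa_fun (\<lambda>a. a > 0) a_max"
    unfolding a_max_def arg_max_def by (rule someI)
  thus "a_max > 0" by (simp add: is_arg_max_linorder)
  have "kappa_fun a0 \<le> kappa" using m a0 by (auto simp: is_arg_max_linorder kappa_def)
  thus "kappa = 3 - 2 * sqrt 2" using le[OF \<open>a_max > 0\<close>] eq by (simp add: kappa_def)
qed

lemma kappa_bounds: "17 / 100 < kappa" "kappa < 18 / 100"
proof -
  have "sqrt 2 < 1415 / 1000" by (rule real_less_lsqrt) (auto simp: power2_eq_square)
  moreover have "sqrt 2 > 141 / 100" by (rule real_less_rsqrt) (auto simp: power2_eq_square)
  ultimately show "17 / 100 < kappa" "kappa < 18 / 100" by (auto simp: a_max_kappa)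
qed

lemma discriminant_factor: "1 - 6 * B + B\<^sup>2 = (kappa - B) * (3 + 2 * sqrt 2 - B)"
  by (simp add: a_max_kappa algebra_simps power2_eq_square)

subsection \<open>Localisation of the trinomial roots\<close>

text \<open>On [0, pi / 3] the derivative cos is at least 1/2. The indices j <= n / 6 keep all
  angles 2 pi j / n in this range.\<close>

lemma sin_diff_ge:
  assumes "0 \<le> a" "a \<le> b" "b \<le> pi / 3"
  shows "(b - a) / 2 \<le> sin b - sin a"
proof -
  have "(\<lambda>x. sin x - x / 2) a \<le> (\<lambda>x. sin x - x / 2) b"
  proof (rule DERIV_nonneg_imp_nondecreasing[OF assms(2)])
    fix y assume y: "a \<le> y" "y \<le> b"
    have "cos (pi / 3) \<le> cos y" using y assms by (intro cos_monotone_0_pi_le) auto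
    thus "\<exists>d. ((\<lambda>x. sin x - x / 2) has_real_derivative d) (at y) \<and> 0 \<le> d"
      by (intro exI[of _ "cos y - 1/2"]) (auto intro!: derivative_eq_intros simp: cos_60)
  qed
  thus ?thesis by (simp add: field_simps)
qed

lemma sin_ge_half:
  assumes "0 \<le> x" "x \<le> pi / 3"
  shows "x / 2 \<le> sin x"
  using sin_diff_ge[of 0 x] assms by simp

text \<open>Written with two half-planes instead of conditions on \<open>Arg\<close>, so that
  closedness and convexity are immediate and 0 is included.\<close>

definition sector :: "real \<Rightarrow> real \<Rightarrow> complex set" where
  "sector a b = {z. cmod z \<le> 1 \<and> 0 \<le> Im (z * cis (- a)) \<and> Im (z * cis (- b)) \<le> 0}"

lemma Im_mult_cis: "Im (z * cis (- a)) = cmod z * sin (Arg z - a)"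
proof -
  have "z * cis (- a) = of_real (cmod z) * cis (Arg z - a)"
    by (subst (1) rcis_cmod_Arg[symmetric]) (simp add: rcis_def cis_mult)
  thus ?thesis by simp
qed

lemma sector_polar:
  assumes "0 < a" "a < b" "b \<le> pi / 3" "z \<in> sector a b" "z \<noteq> 0"
  shows "a \<le> Arg z" "Arg z \<le> b"
proof -
  have "0 \<le> cmod z * sin (Arg z - a)" "cmod z * sin (Arg z - b) \<le> 0"
    using assms(4) unfolding sector_def Im_mult_cis by blast+
  hence z: "0 \<le> sin (Arg z - a)" "sin (Arg z - b) \<le> 0"
    using assms(5) by (auto simp: zero_le_mult_iff mult_le_0_iff)
  have A: "- pi < Arg z" "Arg z \<le> pi" using Arg_bounded by auto
  show "Arg z \<le> b"
  proof (rule ccontr)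
    assume "\<not> Arg z \<le> b"
    hence "sin (Arg z - b) > 0" using assms A by (intro sin_gt_zero) auto
    thus False using z by simp
  qed
  show "a \<le> Arg z"
  proof (rule ccontr)
    assume n: "\<not> a \<le> Arg z"
    show False
    proof (cases "Arg z - a > - pi")
      case True
      hence "sin (a - Arg z) > 0" using n by (intro sin_gt_zero) auto
      thus False using z sin_minus[of "a - Arg z"] by simp
    next
      case False
      \<comment> \<open>Here the argument has wrapped around to the far side of the first
        half-plane; the second half-plane excludes it.\<close>
      hence "sin (Arg z - b + 2 * pi) > 0" using assms A by (intro sin_gt_zero) auto
      thus False using z by simp
    qed
  qed
qed

lemma cmod_one_minus_sq: "(cmod (1 - z))\<^sup>2 = 1 - 2 * cmod z * cos (Arg z) + (cmod z)\<^sup>2"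
proof -
  have "z = rcis (cmod z) (Arg z)" by (simp add: rcis_cmod_Arg)
  hence e: "Re z = cmod z * cos (Arg z)" "Im z = cmod z * sin (Arg z)"
    by (metis Re_rcis, metis Im_rcis)
  have expand: "(1 - m * c)\<^sup>2 + (m * s)\<^sup>2 = 1 - 2 * m * c + m\<^sup>2 * (s\<^sup>2 + c\<^sup>2)" for m c s :: real
    by (simp add: power2_eq_square algebra_simps)
  have "(cmod (1 - z))\<^sup>2 = (1 - Re z)\<^sup>2 + (Im z)\<^sup>2" by (simp add: cmod_power2)
  also have "\<dots> = 1 - 2 * cmod z * cos (Arg z) + (cmod z)\<^sup>2 * ((sin (Arg z))\<^sup>2 + (cos (Arg z))\<^sup>2)"
    unfolding e by (rule expand)
  finally show ?thesis by simp
qed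

text \<open>|sin (Arg z)| is the distance from 1 to the line through 0 in the direction
  \<open>Arg z\<close>; the foot of the perpendicular is at cos (Arg z).\<close>

lemma sin_le_cmod_one_minus: "sin (Arg z) \<le> cmod (1 - z)"
proof (rule power2_le_imp_le)
  have "(cmod (1 - z))\<^sup>2 - (sin (Arg z))\<^sup>2 = (cmod z - cos (Arg z))\<^sup>2"
    unfolding cmod_one_minus_sq by (simp add: sin_squared_eq power2_eq_square algebra_simps)
  thus "(sin (Arg z))\<^sup>2 \<le> (cmod (1 - z))\<^sup>2" by (metis diff_ge_0_iff_ge zero_le_power2)
qed auto

text \<open>The first three facts place 1 - z in the lower right quarter of the disc, so the
  principal logarithm has imaginary part in (-pi/2, 0] and real part at most 0. The upper bound
  holds because |z| <= 1 <= 2 cos (Arg z). The lower bound drives the contraction.\<close>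

lemma sector_one_minus:
  assumes "0 < a" "a < b" "b \<le> pi / 3" "z \<in> sector a b"
  shows "0 < Re (1 - z)" "Im (1 - z) \<le> 0" "cmod (1 - z) \<le> 1" "sin a \<le> cmod (1 - z)"
proof -
  have "0 < Re (1 - z) \<and> Im (1 - z) \<le> 0 \<and> cmod (1 - z) \<le> 1 \<and> sin a \<le> cmod (1 - z)"
  proof (cases "z = 0")
    case True
    thus ?thesis by simp
  next
    case False
    note A = sector_polar[OF assms False]
    have z: "cmod z \<le> 1" using assms by (simp add: sector_def)
    have e: "Re z = cmod z * cos (Arg z)" "Im z = cmod z * sin (Arg z)"
      by (metis Re_rcis rcis_cmod_Arg, metis Im_rcis rcis_cmod_Arg)
    have s: "sin (Arg z) > 0" using A assms by (intro sin_gt_zero) auto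
    have "cos (Arg z) < cos 0" using A assms by (intro cos_monotone_0_pi) auto
    hence c1: "cos (Arg z) < 1" by simp
    have "cos (pi / 3) \<le> cos (Arg z)" using A assms by (intro cos_monotone_0_pi_le) auto
    hence c2: "cos (Arg z) \<ge> 1/2" by (simp add: cos_60)
    have "cmod z * cos (Arg z) \<le> 1 * cos (Arg z)" using z c2 by (intro mult_right_mono) auto
    hence 1: "0 < Re (1 - z)" using c1 e by simp
    have 2: "Im (1 - z) \<le> 0" using e s by simp
    have "cmod z * cmod z \<le> cmod z * 1" using z by (intro mult_left_mono) auto
    moreover have "cmod z * (1/2) \<le> cmod z * cos (Arg z)" using c2 by (intro mult_left_mono) auto
    ultimately have "(cmod (1 - z))\<^sup>2 \<le> 1\<^sup>2"
      unfolding cmod_one_minus_sq by (simp add: power2_eq_square)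
    hence 3: "cmod (1 - z) \<le> 1" by (rule power2_le_imp_le) simp
    have "sin a \<le> sin (Arg z)" using A assms by (intro sin_monotone_2pi_le) auto
    also have "\<dots> \<le> cmod (1 - z)" by (rule sin_le_cmod_one_minus)
    finally show ?thesis using 1 2 3 by blast
  qed
  thus "0 < Re (1 - z)" "Im (1 - z) \<le> 0" "cmod (1 - z) \<le> 1" "sin a \<le> cmod (1 - z)" by auto
qed

lemma closed_sector: "closed (sector a b)"
  unfolding sector_def by (intro closed_Collect_conj closed_Collect_le continuous_intros)

lemma convex_sector: "convex (sector a b)"
proof -
  have "sector a b = cball 0 1 \<inter> {z. inner (Complex (sin (-a)) (cos (-a))) z \<ge> 0}
      \<inter> {z. inner (Complex (sin (-b)) (cos (-b))) z \<le> 0}"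
    by (auto simp: sector_def inner_complex_def algebra_simps)
  thus ?thesis by (auto intro!: convex_Int convex_halfspace_ge convex_halfspace_le)
qed

lemma Im_Ln_lower_right:
  assumes "Re w > 0" "Im w \<le> 0"
  shows "- (pi / 2) < Im (Ln w)" "Im (Ln w) \<le> 0"
proof -
  have w0: "w \<noteq> 0" using assms by auto
  have "\<bar>Im (Ln w)\<bar> < pi / 2" using Re_Ln_pos_lt[OF w0] assms by simp
  thus "- (pi / 2) < Im (Ln w)" "Im (Ln w) \<le> 0"
    using Im_Ln_pos_lt[OF w0] assms pi_gt_zero by auto
qed

text \<open>The roots of \<open>z\<^sup>n = 1 - z\<close> whose argument lies just below \<open>2 \<pi> j / n\<close> are the fixed points of
  the branch \<open>(1 - z)\<^bsup>1/n\<^esup>\<close> numbered \<open>j\<close>, which is a contraction of a convex sector.\<close>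

definition branch_map :: "nat \<Rightarrow> nat \<Rightarrow> complex \<Rightarrow> complex" where
  "branch_map n j z = exp ((2 * pi * real j * \<i> + Ln (1 - z)) / real n)"

abbreviation angle_lower :: "nat \<Rightarrow> nat \<Rightarrow> real" where
  "angle_lower n j \<equiv> (2 * pi * real j - pi / 2) / real n"

abbreviation angle_upper :: "nat \<Rightarrow> nat \<Rightarrow> real" where
  "angle_upper n j \<equiv> 2 * pi * real j / real n"

lemma angles:
  assumes "1 \<le> j" "j \<le> n div 6"
  shows "n \<ge> 6" "0 < angle_lower n j" "angle_lower n j < angle_upper n j" "angle_upper n j \<le> pi / 3"
    "angle_lower n j \<ge> 3 * pi / 2 * j / n"
proof -
  show n: "n \<ge> 6" using assms by linarith
  have j: "real j \<ge> 1" "6 * real j \<le> real n" using assms by linarith+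
  show "angle_lower n j < angle_upper n j" using n pi_gt_zero by (intro divide_strict_right_mono) auto
  have "pi * (6 * real j) \<le> pi * real n" using j by (intro mult_left_mono) auto
  thus "angle_upper n j \<le> pi / 3" using n by (simp add: field_simps)
  have "pi * 1 \<le> pi * real j" using j by (intro mult_left_mono) auto
  hence *: "3 * pi / 2 * j \<le> 2 * pi * real j - pi / 2" by linarith
  thus "angle_lower n j \<ge> 3 * pi / 2 * j / n" using n by (intro divide_right_mono) auto
  have "3 * pi / 2 * j > 0" using j by (intro mult_pos_pos) auto
  thus "0 < angle_lower n j" using * n by (intro divide_pos_pos) auto
qed

lemma branch_map_Im:
  assumes "1 \<le> j" "j \<le> n div 6" "z \<in> sector (angle_lower n j) (angle_upper n j)"
  defines "u \<equiv> (2 * pi * real j * \<i> + Ln (1 - z)) / real n"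
  shows "angle_lower n j \<le> Im u" "Im u \<le> angle_upper n j" "Re u \<le> 0"
proof -
  note ang = angles[OF assms(1,2)]
  note S = sector_one_minus[OF ang(2,3,4) assms(3)]
  have w0: "1 - z \<noteq> 0" using S(1) by force
  have Im: "Im u = (2 * pi * real j + Im (Ln (1 - z))) / real n"
    by (simp add: u_def)
  note L = Im_Ln_lower_right[OF S(1,2)]
  show "angle_lower n j \<le> Im u" "Im u \<le> angle_upper n j"
    unfolding Im using L ang by (intro divide_right_mono; simp)+
  have "Re u = ln (cmod (1 - z)) / real n" using w0 by (simp add: u_def Re_Ln)
  moreover have "ln (cmod (1 - z)) \<le> 0" using S(3) w0 by simp
  ultimately show "Re u \<le> 0" by (simp add: divide_le_0_iff)
qed

text \<open>The derivative has modulus at most 1 / (n |1 - z|), and n |1 - z| >= n sin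
  (\<open>angle_lower n j\<close>) >= 3 pi / 4 > 2, whence the Lipschitz constant 1/2.\<close>

lemma branch_map_fixpoint:
  assumes "1 \<le> j" "j \<le> n div 6"
  shows "\<exists>!z. z \<in> sector (angle_lower n j) (angle_upper n j) \<and> branch_map n j z = z"
proof -
  note ang = angles[OF assms]
  define S where "S = sector (angle_lower n j) (angle_upper n j)"
  have self: "branch_map n j z \<in> S" if "z \<in> S" for z
  proof -
    define u where "u = (2 * pi * real j * \<i> + Ln (1 - z)) / real n"
    note b = branch_map_Im[OF assms that[unfolded S_def], folded u_def]
    have bm: "branch_map n j z = exp u" by (simp only: branch_map_def u_def)
    have e: "branch_map n j z * cis (- t) = of_real (exp (Re u)) * cis (Im u - t)" for t
      unfolding bm exp_eq_polar by (simp add: cis_mult mult.assoc)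
    have "cmod (branch_map n j z) \<le> 1"
      using b by (simp add: bm)
    moreover have "0 \<le> Im (branch_map n j z * cis (- angle_lower n j))"
      unfolding e using b ang by (auto intro!: mult_nonneg_nonneg sin_ge_zero)
    moreover have "Im (branch_map n j z * cis (- angle_upper n j)) \<le> 0"
    proof -
      have "sin (angle_upper n j - Im u) \<ge> 0" using b ang by (intro sin_ge_zero) auto
      hence "sin (Im u - angle_upper n j) \<le> 0" using sin_minus[of "angle_upper n j - Im u"] by simp
      thus ?thesis unfolding e by (auto simp: mult_le_0_iff)
    qed
    ultimately show ?thesis by (simp add: S_def sector_def)
  qed
  have contr: "dist (branch_map n j x) (branch_map n j y) \<le> 1/2 * dist x y" if "x \<in> S" "y \<in> S" for x y
    unfolding dist_norm
  proof (rule field_differentiable_bound[OF _ _ _ that])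
    show "convex S" by (simp add: S_def convex_sector)
    fix z assume z: "z \<in> S"
    note m = sector_one_minus[OF ang(2,3,4) z[unfolded S_def]]
    have "1 - z \<notin> \<real>\<^sub>\<le>\<^sub>0" using m(1) by (auto simp: complex_nonpos_Reals_iff)
    hence "((\<lambda>z. (2 * pi * real j * \<i> + Ln (1 - z)) / real n) has_field_derivative (- 1 / (1 - z) / real n)) (at z)"
      using ang(1) by (auto intro!: derivative_eq_intros simp: divide_simps)
    hence "(branch_map n j has_field_derivative branch_map n j z * (- 1 / (1 - z) / real n)) (at z)"
      unfolding branch_map_def by (rule DERIV_chain2[OF DERIV_exp])
    thus "(branch_map n j has_field_derivative branch_map n j z * (- 1 / (1 - z) / real n)) (at z within S)"
      by (rule has_field_derivative_at_within)
    have "2 \<le> n * (angle_lower n j / 2)"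
    proof -
      have "3 * pi / 2 * 1 \<le> 3 * pi / 2 * real j" using assms by (intro mult_left_mono) auto
      also have "\<dots> = n * (3 * pi / 2 * j / n)" using ang by simp
      also have "\<dots> \<le> n * angle_lower n j" using ang by (intro mult_left_mono) auto
      finally have "3 * pi / 2 * 1 \<le> real n * angle_lower n j" .
      moreover have "2 \<le> x / 2" if "3 * pi / 2 * 1 \<le> x" for x using that pi_gt3 by linarith
      ultimately show ?thesis by (subst times_divide_eq_right) blast
    qed
    also have "\<dots> \<le> n * sin (angle_lower n j)"
      by (intro mult_left_mono sin_ge_half less_imp_le[OF ang(2)]
            order_trans[OF less_imp_le[OF ang(3)] ang(4)]) auto
    also have "\<dots> \<le> n * cmod (1 - z)" using m by (intro mult_left_mono) auto
    finally have *: "2 \<le> n * cmod (1 - z)" .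
    have "norm (branch_map n j z * (- 1 / (1 - z) / real n)) = cmod (branch_map n j z) * (1 / (n * cmod (1 - z)))"
      by (simp add: norm_mult norm_divide)
    also have "\<dots> \<le> 1 * (1 / 2)"
      using self[OF z] * by (intro mult_mono divide_left_mono) (auto simp: S_def sector_def)
    finally show "norm (branch_map n j z * (- 1 / (1 - z) / real n)) \<le> 1 / 2" by simp
  qed
  have "\<exists>!x\<in>S. branch_map n j x = x"
  proof (rule Banach_fix[where c = "1/2"])
    show "complete S" by (simp add: S_def closed_sector complete_eq_closed)
    show "S \<noteq> {}" by (auto simp: S_def sector_def intro!: exI[of _ 0])
    show "branch_map n j ` S \<subseteq> S" using self by auto
    show "dist (branch_map n j x) (branch_map n j y) \<le> 1/2 * dist x y" if "x \<in> S" "y \<in> S" for x y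
      by (rule contr[OF that])
  qed auto
  thus ?thesis by (simp add: S_def)
qed

section \<open>Matching the fixed points with the sorted list of roots\<close>

lemma finite_Gtri_roots: "finite {z :: complex. Gtri n z = 0 \<and> P z}" if "n \<ge> 2"
proof -
  define p :: "complex poly" where "p = Polynomial.monom 1 n + [:-1, 1:]"
  have "Polynomial.coeff p n = 1" using that by (simp add: p_def Polynomial.coeff_pCons split: nat.splits)
  hence "p \<noteq> 0" by auto
  hence "finite {z. poly p z = 0}" by (rule poly_roots_finite)
  thus ?thesis by (rule rev_finite_subset) (auto simp: p_def Gtri_def poly_monom algebra_simps)
qed

definition inner_upper_roots :: "nat \<Rightarrow> complex set" where
  "inner_upper_roots n = {z. Gtri n z = 0 \<and> cmod z < 1 \<and> Im z > 0}"

text \<open>If x = t y with t > 0, then 1 - x = t^n (1 - y). Imaginary parts give t^n = t, and then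
  real parts give t = 1. Injectivity of the key is what makes sorting by argument well
  behaved.\<close>

lemma Arg_inj_on_inner_upper_roots: "inj_on Arg (inner_upper_roots n)"
proof (rule inj_onI)
  fix x y assume xy: "x \<in> inner_upper_roots n" "y \<in> inner_upper_roots n" "Arg x = Arg y"
  define t where "t = cmod x / cmod y"
  have y0: "y \<noteq> 0" "x \<noteq> 0" using xy by (auto simp: inner_upper_roots_def)
  have "of_real t * y = of_real t * rcis (cmod y) (Arg y)" by (simp add: rcis_cmod_Arg)
  also have "\<dots> = rcis (cmod x) (Arg x)" using y0 xy(3) by (simp add: rcis_def t_def)
  finally have x: "x = of_real t * y" by (simp add: rcis_cmod_Arg)
  have "1 - x = x ^ n" "1 - y = y ^ n" using xy by (auto simp: inner_upper_roots_def Gtri_def algebra_simps)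
  hence "1 - x = of_real (t ^ n) * (1 - y)" by (simp add: x power_mult_distrib)
  hence e: "Im (1 - x) = t ^ n * Im (1 - y)" "Re (1 - x) = t ^ n * Re (1 - y)" by simp_all
  have tn: "t ^ n = t" using e(1) xy unfolding x by (auto simp: inner_upper_roots_def)
  have "t = 1" using e(2) unfolding x tn by (simp add: algebra_simps)
  thus "x = y" using x by simp
qed

text \<open>Taking logarithms in z^n = 1 - z gives n Ln z = Ln (1 - z) + 2 pi i k. The imaginary
  part of Ln (1 - z) lies in (-pi/2, 0) and that of Ln z is positive, so k >= 1 is the branch
  number.\<close>

lemma inner_upper_roots_in_sector:
  assumes "z \<in> inner_upper_roots n" "n \<ge> 2"
  obtains k where "k \<ge> 1" "angle_lower n k < Arg z" "Arg z < angle_upper n k" "branch_map n k z = z"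
    "k \<le> n div 6 \<Longrightarrow> z \<in> sector (angle_lower n k) (angle_upper n k)"
proof -
  have z: "z ^ n = 1 - z" "cmod z < 1" "Im z > 0" "z \<noteq> 0"
    using assms by (auto simp: inner_upper_roots_def Gtri_def algebra_simps)
  have "Re z < 1" using z(2) complex_Re_le_cmod[of z] by linarith
  hence re: "Re (1 - z) > 0" by simp
  have w0: "1 - z \<noteq> 0" using re by force
  note L = Im_Ln_lower_right[OF re]
  have Lneg: "Im (Ln (1 - z)) < 0"
    using L Im_Ln_eq_0[OF w0] z by (auto simp: less_le)
  have "exp (of_nat n * Ln z) = exp (Ln (1 - z))"
    using z w0 by (simp add: exp_of_nat_mult)
  then obtain k :: int where k: "of_nat n * Ln z = Ln (1 - z) + (of_int (2 * k) * pi) * \<i>"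
    unfolding exp_eq by blast
  have I: "n * Im (Ln z) = Im (Ln (1 - z)) + 2 * pi * k"
    using arg_cong[OF k, of Im] by simp
  have "Im (Ln z) > 0" using Im_Ln_pos_lt[OF z(4)] z by simp
  hence "n * Im (Ln z) > 0" using assms by simp
  hence "2 * pi * k > 0" using I Lneg by linarith
  hence "k > 0" by (simp add: zero_less_mult_iff)
  define m where "m = nat k"
  have m: "m \<ge> 1" "real m = k" "k = int m" using \<open>k > 0\<close> by (auto simp: m_def)
  have A: "Arg z = Im (Ln z)" using z by (simp add: Arg_eq_Im_Ln)
  have Az: "Arg z = (2 * pi * m + Im (Ln (1 - z))) / n"
    using I assms by (simp add: A m(2) field_simps)
  have 1: "angle_lower n m < Arg z" "Arg z < angle_upper n m"
    unfolding Az using Lneg L z assms by (intro divide_strict_right_mono; simp)+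
  have "Ln z = (2 * pi * real m * \<i> + Ln (1 - z)) / real n"
    using k assms by (simp add: m(3) field_simps)
  hence 2: "branch_map n m z = z" unfolding branch_map_def using z by (metis exp_Ln)
  show ?thesis
  proof (rule that[OF m(1) 1 2])
    assume "m \<le> n div 6"
    note ang = angles[OF m(1) this]
    have "0 \<le> sin (Arg z - angle_lower n m)" using 1 ang by (intro sin_ge_zero) auto
    moreover have "0 \<le> sin (angle_upper n m - Arg z)" using 1 ang by (intro sin_ge_zero) auto
    hence "sin (Arg z - angle_upper n m) \<le> 0" using sin_minus[of "Arg z - angle_upper n m"] by simp
    ultimately show "z \<in> sector (angle_lower n m) (angle_upper n m)"
      unfolding sector_def Im_mult_cis using z by (auto simp: mult_le_0_iff)
  qed
qed

text \<open>The closed sector also contains points of modulus 1, which must be excluded: there |1 -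
  z| = |z|^n = 1, whereas an argument below pi / 3 gives |1 - z| < 1.\<close>

lemma branch_fixpoint_in_inner_upper_roots:
  assumes "1 \<le> j" "j \<le> n div 6" "z \<in> sector (angle_lower n j) (angle_upper n j)" "branch_map n j z = z"
  shows "z \<in> inner_upper_roots n"
proof -
  note ang = angles[OF assms(1,2)]
  note m = sector_one_minus[OF ang(2,3,4) assms(3)]
  have w0: "1 - z \<noteq> 0" using m(1) by force
  define u where "u = (2 * pi * real j * \<i> + Ln (1 - z)) / real n"
  note b = branch_map_Im[OF assms(1,2,3), folded u_def]
  have zu: "z = exp u" using assms(4) by (simp only: branch_map_def u_def)
  hence z0: "z \<noteq> 0" by simp
  have "z ^ n = exp (real n * u)" unfolding zu by (simp add: exp_of_nat_mult)
  also have "real n * u = 2 * pi * real j * \<i> + Ln (1 - z)" using ang by (simp add: u_def)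
  also have "exp \<dots> = 1 - z"
    using w0 exp_integer_2pi[of "of_nat j"] by (simp add: exp_add mult_ac)
  finally have zn: "z ^ n = 1 - z" .
  have Lu: "Ln z = u" unfolding zu using b ang by (intro Ln_exp) auto
  hence Au: "Arg z = Im u" using z0 by (simp add: Arg_eq_Im_Ln)
  have "sin (Im u) > 0" using b ang by (intro sin_gt_zero) auto
  hence Imz: "Im z > 0" unfolding zu by (simp add: Im_exp)
  have L0: "Im (Ln (1 - z)) < 0"
    using Im_Ln_lower_right[OF m(1,2)] Im_Ln_eq_0[OF w0] Imz by (auto simp: less_le)
  have "cmod z \<noteq> 1"
  proof
    assume c: "cmod z = 1"
    have "Im u < angle_upper n j"
      unfolding u_def using L0 ang by (simp add: divide_strict_right_mono)
    hence "cos (pi / 3) < cos (Arg z)" unfolding Au using b ang by (intro cos_monotone_0_pi) auto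
    hence "(cmod (1 - z))\<^sup>2 < 1" unfolding cmod_one_minus_sq c by (simp add: cos_60)
    moreover have "cmod (1 - z) = 1" unfolding zn[symmetric] by (simp add: norm_power c)
    ultimately show False by simp
  qed
  moreover have "cmod z \<le> 1" using assms by (simp add: sector_def)
  ultimately show ?thesis using zn Imz by (simp add: inner_upper_roots_def Gtri_def)
qed

text \<open>Bridges the constant used in \<open>zroot\<close> and the locale constant about which
  the facts of \<open>folding_insort_key\<close> speak.\<close>

lemma linorder_sorted_key_list_of_set_eq:
  "linorder.sorted_key_list_of_set (\<le>) (f :: 'b \<Rightarrow> 'a::linorder) = sorted_key_list_of_set f"
proof -
  have "linorder.insort_key (\<le>) f x xs = insort_key f x xs" for x xs
    by (induction xs) (simp_all add: linorder.insort_key.simps[OF linorder_class.linorder_axioms])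
  hence "linorder.insort_key (\<le>) f = insort_key f" by blast
  thus ?thesis
    unfolding sorted_key_list_of_set_def
      linorder.sorted_key_list_of_set_def[OF linorder_class.linorder_axioms] by simp
qed

text \<open>The sectors of different branches are disjoint and ordered by argument. Every other root
  has a branch number above n div 6 and so comes later; hence the fixed point of branch j is entry j
  - 1 of the sorted list.\<close>

lemma zroot_props:
  assumes "1 \<le> j" "j \<le> n div 6"
  shows "zroot n j \<in> inner_upper_roots n" "angle_lower n j \<le> Arg (zroot n j)" "Arg (zroot n j) \<le> angle_upper n j"
proof -
  define K where "K = n div 6"
  define g where "g = (\<lambda>i. THE z. z \<in> sector (angle_lower n (Suc i)) (angle_upper n (Suc i)) \<and> branch_map n (Suc i) z = z)"
  have n: "n \<ge> 6" using assms by linarith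
  have g: "g i \<in> sector (angle_lower n (Suc i)) (angle_upper n (Suc i))" "branch_map n (Suc i) (g i) = g i"
    if "i < K" for i
    using theI'[OF branch_map_fixpoint[of "Suc i" n]] that unfolding g_def K_def by auto
  have gu: "z = g i" if "i < K" "z \<in> sector (angle_lower n (Suc i)) (angle_upper n (Suc i))" "branch_map n (Suc i) z = z"
    for i z
    using branch_map_fixpoint[of "Suc i" n] g[OF that(1)] that unfolding K_def by auto
  have gZ: "g i \<in> inner_upper_roots n" if "i < K" for i
    using branch_fixpoint_in_inner_upper_roots[of "Suc i" n "g i"] g[OF that] that by (auto simp: K_def)
  have gA: "angle_lower n (Suc i) \<le> Arg (g i)" "Arg (g i) \<le> angle_upper n (Suc i)" if "i < K" for i
  proof -
    have "g i \<noteq> 0" using gZ[OF that] by (auto simp: inner_upper_roots_def)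
    moreover have "1 \<le> Suc i" "Suc i \<le> n div 6" using that by (auto simp: K_def)
    ultimately show "angle_lower n (Suc i) \<le> Arg (g i)" "Arg (g i) \<le> angle_upper n (Suc i)"
      using sector_polar g(1)[OF that] angles[of "Suc i" n] by blast+
  qed
  have step: "angle_upper n i < angle_lower n k" if "i < k" for i k :: nat
  proof -
    have "pi * (real i + 1) \<le> pi * real k" using that by (intro mult_left_mono) auto
    hence "2 * pi * real i < 2 * pi * real k - pi / 2" using pi_gt_zero unfolding distrib_left by linarith
    thus ?thesis using n by (intro divide_strict_right_mono) auto
  qed
  have mono: "Arg (g i) < Arg (g k)" if "i < k" "k < K" for i k
    using gA[of i] gA[of k] that step[of "Suc i" "Suc k"] by simp
  define R where "R = inner_upper_roots n - g ` {..<K}"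
  have fin: "finite (inner_upper_roots n)" unfolding inner_upper_roots_def using finite_Gtri_roots n by simp
  have RA: "Arg (g i) < Arg z" if z: "z \<in> R" and i: "i < K" for z i
  proof -
    have "z \<in> inner_upper_roots n" using z by (simp add: R_def)
    moreover have "n \<ge> 2" using n by simp
    ultimately obtain k where k: "k \<ge> 1" "angle_lower n k < Arg z" "branch_map n k z = z"
      "k \<le> n div 6 \<Longrightarrow> z \<in> sector (angle_lower n k) (angle_upper n k)" by (rule inner_upper_roots_in_sector) blast
    have "\<not> k \<le> K"
    proof
      assume "k \<le> K"
      hence "z = g (k - 1)" using gu[of "k - 1" z] k by (auto simp: K_def)
      thus False using z \<open>k \<le> K\<close> k(1) by (auto simp: R_def)
    qed
    thus ?thesis using gA(2)[OF i] step[of "Suc i" k] k(2) i by linarith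
  qed
  have lo: "folding_insort_key (\<le>) (<) (inner_upper_roots n) Arg"
    by unfold_locales (rule Arg_inj_on_inner_upper_roots)
  define rs where "rs = sorted_key_list_of_set Arg R"
  have R: "R \<subseteq> inner_upper_roots n" "finite R" using fin by (auto simp: R_def)
  have rs: "set rs = R" "sorted (map Arg rs)" "distinct rs"
    using folding_insort_key.sorted_key_list_of_set[OF lo R(1), unfolded linorder_sorted_key_list_of_set_eq] R(2)
    by (auto simp: rs_def distinct_map)
  \<comment> \<open>A sorted duplicate-free enumeration is unique, so it suffices to exhibit one
    that begins with the fixed points.\<close>
  define ys where "ys = map g [0..<K] @ rs"
  have set: "set ys = inner_upper_roots n" using gZ rs by (auto simp: ys_def R_def)
  have "sorted_wrt (<) (map Arg (map g [0..<K]))"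
    unfolding sorted_wrt_iff_nth_less using mono by auto
  hence s1: "sorted (map Arg (map g [0..<K]))" "distinct (map Arg (map g [0..<K]))"
    by (simp_all add: strict_sorted_iff)
  have "sorted (map Arg ys)"
    unfolding ys_def map_append sorted_append using s1 rs RA by (auto intro: less_imp_le)
  moreover have "distinct ys"
    unfolding ys_def using s1(2) rs by (auto simp: distinct_map R_def intro: inj_on_imageI2)
  ultimately have "sorted_key_list_of_set Arg (set ys) = ys"
    using set folding_insort_key.idem_if_sorted_distinct[OF lo, of ys, unfolded linorder_sorted_key_list_of_set_eq]
    by simp
  hence "zroot n j = ys ! (j - 1)" unfolding zroot_def set inner_upper_roots_def by simp
  moreover have jK: "j - 1 < K" "Suc (j - 1) = j" using assms by (auto simp: K_def)
  moreover have "ys ! (j - 1) = g (j - 1)" using jK by (simp add: ys_def nth_append)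
  ultimately have "zroot n j = g (j - 1)" by simp
  with jK show "zroot n j \<in> inner_upper_roots n" "angle_lower n j \<le> Arg (zroot n j)" "Arg (zroot n j) \<le> angle_upper n j"
    using gZ[of "j - 1"] gA[of "j - 1"] by auto
qed

text \<open>This is |1 - exp (2 pi i j / n)|, the first approximation to |1 - z_j|.\<close>

abbreviation node :: "nat \<Rightarrow> nat \<Rightarrow> real" where
  "node n j \<equiv> 2 * sin (pi * real j / real n)"

lemma node_ge:
  assumes "1 \<le> j" "j \<le> n div 6"
  shows "2 * real j / real n \<le> node n j" "node n j \<le> 1" "0 < node n j"
proof -
  note ang = angles[OF assms]
  have h: "pi * real j / real n = angle_upper n j / 2" by simp
  have x: "0 \<le> pi * real j / real n" "pi * real j / real n \<le> pi / 6"
    using divide_right_mono[OF ang(4), of 2] unfolding h by simp_all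
  have "2 * real j / real n \<le> pi * real j / real n"
    using pi_gt3 ang(1) by (intro divide_right_mono mult_right_mono) auto
  also have "\<dots> \<le> node n j"
    using sin_ge_half[of "pi * real j / real n"] x pi_gt_zero by simp
  finally show ge: "2 * real j / real n \<le> node n j" .
  have "0 < 2 * real j / real n" using assms ang by (intro divide_pos_pos) auto
  thus "0 < node n j" using ge by linarith
  have "sin (pi * real j / real n) \<le> sin (pi / 6)" using x pi_gt_zero by (intro sin_monotone_2pi_le) linarith+
  thus "node n j \<le> 1" by (simp add: sin_30)
qed

text \<open>By w^n = 1 - w the size of w is governed by |1 - w|, which is at least sin (Arg w). The
  chord estimate passes through \<open>cis (Arg w)\<close>: the radial error is at most ln n / n,
  the angular one at most pi / (2 n). The last claim is one-sided but free of ln n, hence precise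
  enough near kappa.\<close>

lemma zroot_estimates:
  assumes "1 \<le> j" "j \<le> n div 6"
  defines "w \<equiv> zroot n j"
  shows "w \<noteq> 0" "cmod w < 1" "ln (cmod w) = ln (cmod (1 - w)) / n"
    "2 * real j / real n \<le> cmod (1 - w)" "cmod (1 - w) \<le> 1"
    "1 - cmod w \<le> ln n / n"
    "\<bar>cmod (1 - w) - node n j\<bar> \<le> (ln n + 2) / n"
    "2 * sin ((pi * real j - pi / 4) / n) \<le> cmod (-1 + w) / cmod w"
proof -
  note ang = angles[OF assms(1,2)]
  have n: "real n \<ge> 6" using ang by simp
  note z = zroot_props[OF assms(1,2), folded w_def]
  have w: "w ^ n = 1 - w" "cmod w < 1" "Im w > 0"
    using z(1) by (auto simp: inner_upper_roots_def Gtri_def algebra_simps)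
  show w0: "w \<noteq> 0" using w by auto
  show "cmod w < 1" by fact
  have c: "cmod w ^ n = cmod (1 - w)" using w(1) by (simp add: norm_power[symmetric])
  show l: "ln (cmod w) = ln (cmod (1 - w)) / n"
    unfolding c[symmetric] using w0 n by (simp add: ln_realpow)
  have "2 * real j / real n \<le> (3 * pi / 2 * j / n) / 2"
  proof -
    have "2 * real j \<le> (3 * pi / 4) * real j" using pi_gt3 by (intro mult_right_mono) auto
    hence "2 * real j / real n \<le> (3 * pi / 4) * real j / real n" by (intro divide_right_mono) auto
    thus ?thesis by simp
  qed
  also have "\<dots> \<le> Arg w / 2" using ang z by simp
  also have "\<dots> \<le> sin (Arg w)" using z ang by (intro sin_ge_half) linarith+
  also have "\<dots> \<le> cmod (1 - w)" by (rule sin_le_cmod_one_minus)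
  finally show lower: "2 * real j / real n \<le> cmod (1 - w)" .
  show "cmod (1 - w) \<le> 1" unfolding c[symmetric] using w by (intro power_le_one) auto
  have "0 < 2 * real j / real n" using assms ang by (intro divide_pos_pos) auto
  hence pos: "0 < cmod (1 - w)" using lower by linarith
  have "1 / real n \<le> 2 * real j / real n" using assms by (intro divide_right_mono) auto
  hence "ln (1 / real n) \<le> ln (cmod (1 - w))" using lower n by (intro ln_mono) auto
  hence "- ln (cmod (1 - w)) \<le> ln n" using n by (simp add: ln_div)
  hence "- ln (cmod (1 - w)) / n \<le> ln n / n" by (intro divide_right_mono) auto
  hence "- ln (cmod w) \<le> ln n / n" unfolding l by simp
  moreover have "ln (cmod w) \<le> cmod w - 1" using w0 by (intro ln_le_minus_one) auto
  ultimately show r: "1 - cmod w \<le> ln n / n" by linarith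
  have rc: "w = rcis (cmod w) (Arg w)" by (simp add: rcis_cmod_Arg)
  have d1: "cmod (w - cis (Arg w)) = 1 - cmod w"
  proof -
    have "w - cis (Arg w) = of_real (cmod w - 1) * cis (Arg w)"
      by (subst (1) rc) (simp add: rcis_def algebra_simps)
    thus ?thesis using w by (simp add: norm_mult del: of_real_diff)
  qed
  have chord: "cmod (cis t - 1) = 2 * \<bar>sin (t / 2)\<bar>" for t
    using dist_exp_i_1[of t] by (simp add: cis_conv_exp)
  have d2: "cmod (cis (Arg w) - cis (angle_upper n j)) \<le> pi / 2 / n"
  proof -
    have "cis (Arg w) - cis (angle_upper n j) = cis (angle_upper n j) * (cis (Arg w - angle_upper n j) - 1)"
      by (simp add: algebra_simps cis_mult)
    hence "cmod (cis (Arg w) - cis (angle_upper n j)) = 2 * \<bar>sin ((Arg w - angle_upper n j) / 2)\<bar>"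
      by (simp only: norm_mult norm_cis chord mult_1)
    also have "\<dots> \<le> 2 * \<bar>(Arg w - angle_upper n j) / 2\<bar>" by (intro mult_left_mono abs_sin_x_le_abs_x) auto
    also have "\<dots> = angle_upper n j - Arg w" using z by simp
    also have "\<dots> \<le> angle_upper n j - angle_lower n j" using z by simp
    also have "\<dots> = pi / 2 / n" by (simp add: diff_divide_distrib)
    finally show ?thesis .
  qed
  have node: "cmod (1 - cis (angle_upper n j)) = node n j"
    using node_ge[OF assms(1,2)] chord[of "angle_upper n j"] by (simp add: norm_minus_commute)
  have "\<bar>cmod (1 - w) - cmod (1 - cis (angle_upper n j))\<bar> \<le> cmod ((1 - w) - (1 - cis (angle_upper n j)))"
    by (rule norm_triangle_ineq3)
  also have "(1 - w) - (1 - cis (angle_upper n j)) = (cis (angle_upper n j) - cis (Arg w)) + (cis (Arg w) - w)" by simp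
  also have "cmod \<dots> \<le> cmod (cis (angle_upper n j) - cis (Arg w)) + cmod (cis (Arg w) - w)"
    by (rule norm_triangle_ineq)
  also have "\<dots> \<le> pi / 2 / n + ln n / n"
    using d1 d2 r by (simp add: norm_minus_commute)
  also have "\<dots> = (ln n + pi / 2) / n" by (simp add: add_divide_distrib)
  also have "\<dots> \<le> (ln n + 2) / n" using pi_less_4 n by (intro divide_right_mono) auto
  finally show "\<bar>cmod (1 - w) - node n j\<bar> \<le> (ln n + 2) / n" unfolding node .
  show "2 * sin ((pi * real j - pi / 4) / n) \<le> cmod (-1 + w) / cmod w"
  proof -
    have h: "(pi * real j - pi / 4) / n = angle_lower n j / 2" by (simp add: field_simps)
    have "sin (a / 2) \<le> sin (t / 2)" if "0 < a" "a \<le> t" "t \<le> b" "b \<le> pi / 3" for a b t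
      using that pi_gt_zero by (intro sin_monotone_2pi_le) linarith+
    from this[OF ang(2) z(2,3) ang(4)] have "sin (angle_lower n j / 2) \<le> sin (Arg w / 2)" .
    \<comment> \<open>With r = |w| and c = cos (Arg w): |1 - w|^2 = (1 - r)^2 + r (2 - 2 c), which
      is at least r^2 (2 - 2 c).\<close>
    moreover have "2 * sin (Arg w / 2) \<le> cmod (1 - w) / cmod w"
    proof (rule power2_le_imp_le)
      define r where "r = cmod w"
      have r: "0 < r" "r < 1" using w0 w by (auto simp: r_def)
      have s: "(2 * sin (Arg w / 2))\<^sup>2 = 2 - 2 * cos (Arg w)"
        using cos_double_sin[of "Arg w / 2"] by (simp add: power2_eq_square)
      have "r\<^sup>2 * (2 - 2 * cos (Arg w)) \<le> r * (2 - 2 * cos (Arg w))"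
        using r by (intro mult_right_mono) (auto simp: power2_eq_square)
      also have "\<dots> \<le> (1 - r)\<^sup>2 + r * (2 - 2 * cos (Arg w))" by simp
      also have "\<dots> = (cmod (1 - w))\<^sup>2"
        unfolding cmod_one_minus_sq r_def[symmetric] by (simp add: power2_eq_square algebra_simps)
      finally show "(2 * sin (Arg w / 2))\<^sup>2 \<le> (cmod (1 - w) / cmod w)\<^sup>2"
        using r unfolding s r_def[symmetric] by (simp add: power_divide field_simps)
    qed auto
    ultimately have "2 * sin (angle_lower n j / 2) \<le> cmod (1 - w) / cmod w"
      by (meson mult_left_mono order_trans zero_le_numeral)
    thus ?thesis unfolding h by (simp add: norm_minus_commute)
  qed
qed

subsection \<open>The integrand\<close>

lemma abs_ln_diff_le:
  fixes p q c :: real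
  assumes "0 < c" "c \<le> p" "c \<le> q"
  shows "\<bar>ln p - ln q\<bar> \<le> \<bar>p - q\<bar> / c"
proof -
  have *: "ln p - ln q \<le> \<bar>p - q\<bar> / c" if "c \<le> p" "c \<le> q" for p q
  proof -
    have "ln p - ln q = ln (p / q)" using assms that by (simp add: ln_div)
    also have "\<dots> \<le> p / q - 1" using assms that by (intro ln_le_minus_one) auto
    also have "\<dots> = (p - q) / q" using assms that by (simp add: field_simps)
    also have "\<dots> \<le> \<bar>p - q\<bar> / q" using assms that by (intro divide_right_mono) auto
    also have "\<dots> \<le> \<bar>p - q\<bar> / c" using assms that by (intro divide_left_mono) auto
    finally show ?thesis .
  qed
  from *[OF assms(2,3)] *[OF assms(3,2)] show ?thesis by (simp add: abs_minus_commute abs_le_iff)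
qed

lemma abs_sqrt_diff_le:
  assumes "0 \<le> x" "0 \<le> y"
  shows "\<bar>sqrt x - sqrt y\<bar> \<le> sqrt \<bar>x - y\<bar>"
proof -
  have *: "sqrt x \<le> sqrt y + sqrt \<bar>x - y\<bar>" if "0 \<le> x" "0 \<le> y" for x y
  proof -
    have "sqrt x \<le> sqrt (y + \<bar>x - y\<bar>)" by simp
    also have "\<dots> \<le> sqrt y + sqrt \<bar>x - y\<bar>" using that by (intro sqrt_add_le_add_sqrt) auto
    finally show ?thesis .
  qed
  from *[OF assms] *[OF assms(2,1)] show ?thesis by (simp add: abs_minus_commute abs_le_iff)
qed

abbreviation disc :: "real \<Rightarrow> real" where
  "disc B \<equiv> 1 - 6 * B + B\<^sup>2"

text \<open>The quantity D as a function of B alone: \<open>D_coef n j\<close> is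
  \<open>Phi (B_coef n j)\<close>.\<close>

definition Phi :: "real \<Rightarrow> real" where
  "Phi B = ln ((1 + B - sqrt (disc B)) / (4 * B))"

lemma disc_bounds:
  assumes "0 \<le> B" "B \<le> kappa"
  shows "kappa - B \<le> disc B" "0 \<le> disc B" "sqrt (disc B) \<le> 1 - B"
proof -
  have "sqrt 2 \<ge> 1" by simp
  hence "3 + 2 * sqrt 2 - B \<ge> 1" using assms kappa_bounds by linarith
  hence "(kappa - B) * 1 \<le> (kappa - B) * (3 + 2 * sqrt 2 - B)"
    using assms by (intro mult_left_mono) auto
  thus 1: "kappa - B \<le> disc B" by (simp add: discriminant_factor)
  thus "0 \<le> disc B" using assms by linarith
  show "sqrt (disc B) \<le> 1 - B"
    using assms kappa_bounds by (intro real_le_lsqrt) (auto simp: power2_eq_square algebra_simps)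
qed

text \<open>Rationalising with (1 + B)^2 - \<open>disc B\<close> = 8 B removes the quotient 0/0 at B
  = 0 and leaves a denominator between 1 and 2.\<close>

lemma Phi_arg:
  assumes "0 < B" "B \<le> kappa"
  shows "(1 + B - sqrt (disc B)) / (4 * B) = 2 / (1 + B + sqrt (disc B))"
    "1 \<le> 1 + B + sqrt (disc B)" "1 + B + sqrt (disc B) \<le> 2"
proof -
  note d = disc_bounds[OF less_imp_le[OF assms(1)] assms(2)]
  show 1: "1 \<le> 1 + B + sqrt (disc B)" "1 + B + sqrt (disc B) \<le> 2"
    using d assms by auto
  have "(sqrt (disc B))\<^sup>2 = disc B" using d by simp
  hence "(1 + B - sqrt (disc B)) * (1 + B + sqrt (disc B)) = 2 * (4 * B)"
    by (simp add: algebra_simps power2_eq_square)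
  thus "(1 + B - sqrt (disc B)) / (4 * B) = 2 / (1 + B + sqrt (disc B))"
    using assms 1 by (subst frac_eq_eq) auto
qed

lemma exp_Phi:
  assumes "0 < B" "B \<le> kappa"
  shows "exp (Phi B) = 2 / (1 + B + sqrt (disc B))" "Phi B = ln 2 - ln (1 + B + sqrt (disc B))"
    "0 \<le> Phi B" "Phi B \<le> 1"
proof -
  note p = Phi_arg[OF assms]
  show "exp (Phi B) = 2 / (1 + B + sqrt (disc B))" unfolding Phi_def p(1) using p(2) by simp
  show e: "Phi B = ln 2 - ln (1 + B + sqrt (disc B))" unfolding Phi_def p(1) using p(2) by (simp add: ln_div)
  have "ln (1 + B + sqrt (disc B)) \<le> ln 2" using p by simp
  thus "0 \<le> Phi B" unfolding e by simp
  have "ln 2 \<le> (2::real) - 1" by (intro ln_le_minus_one) auto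
  moreover have "0 \<le> ln (1 + B + sqrt (disc B))" using p(2) by simp
  ultimately show "Phi B \<le> 1" unfolding e by simp
qed

text \<open>Only Hoelder continuity of exponent 1/2 can hold up to kappa, where the square root of
  the discriminant has a vertical tangent. The 6 bounds |6 - B - C|.\<close>

lemma Phi_diff_le:
  assumes "0 < B" "B \<le> kappa" "0 < C" "C \<le> kappa"
  shows "\<bar>Phi B - Phi C\<bar> \<le> \<bar>B - C\<bar> + sqrt (6 * \<bar>B - C\<bar>)"
proof -
  note B = disc_bounds[OF less_imp_le[OF assms(1)] assms(2)]
  note C = disc_bounds[OF less_imp_le[OF assms(3)] assms(4)]
  have "\<bar>Phi B - Phi C\<bar> = \<bar>ln (1 + C + sqrt (disc C)) - ln (1 + B + sqrt (disc B))\<bar>"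
    using assms by (simp add: exp_Phi(2))
  also have "\<dots> \<le> \<bar>(1 + C + sqrt (disc C)) - (1 + B + sqrt (disc B))\<bar> / 1"
    using Phi_arg assms by (intro abs_ln_diff_le) auto
  also have "\<dots> \<le> \<bar>B - C\<bar> + \<bar>sqrt (disc B) - sqrt (disc C)\<bar>"
  proof -
    have "\<bar>(1 + C + r) - (1 + B + t)\<bar> / 1 \<le> \<bar>B - C\<bar> + \<bar>t - r\<bar>" for r t by simp
    thus ?thesis .
  qed
  also have "\<bar>sqrt (disc B) - sqrt (disc C)\<bar> \<le> sqrt \<bar>disc B - disc C\<bar>"
    using B C by (intro abs_sqrt_diff_le) auto
  also have "\<bar>disc B - disc C\<bar> = \<bar>B - C\<bar> * \<bar>6 - B - C\<bar>"
    unfolding abs_mult[symmetric] by (subst abs_minus_cancel[symmetric]) (simp add: power2_eq_square algebra_simps)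
  also have "\<dots> \<le> \<bar>B - C\<bar> * 6"
    using assms kappa_bounds by (intro mult_left_mono) auto
  finally show ?thesis by (simp add: mult.commute)
qed

text \<open>Numerator and denominator add up to 1, and the denominator collapses to t = 2 s / (1 - B
  + s) with s = sqrt (\<open>disc B\<close>). The quotient is (1 - t) / t, and sqrt (kappa - B) <= s
  <= t <= 2.\<close>

lemma perturbation_bound:
  assumes "0 < B" "B < kappa"
  defines "D \<equiv> Phi B"
  shows "\<bar>(-3 + exp (- D) + 2 * exp D) / (4 - exp (- D) - 2 * exp D)\<bar> \<le> 1 / sqrt (kappa - B)"
proof -
  define s where "s = sqrt (disc B)"
  note d = disc_bounds[OF less_imp_le[OF assms(1)] less_imp_le[OF assms(2)]]
  have s: "0 < s" "s \<le> 1 - B" "s\<^sup>2 = disc B" "sqrt (kappa - B) \<le> s"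
    using d assms by (auto simp: s_def)
  have B: "B < 1" using assms kappa_bounds by linarith
  have e: "exp D = 2 / (1 + B + s)" "exp (-D) = (1 + B + s) / 2"
    using exp_Phi(1)[of B] assms by (auto simp: D_def s_def exp_minus)
  define t where "t = 2 * s / (1 - B + s)"
  have p: "1 + B + s > 0" "1 - B + s > 0" using s assms B by linarith+
  have "(1 + B + s) * (1 - B + s) * (4 - (1 + B + s) / 2 - 4 / (1 + B + s)) = 2 * s * (1 + B + s)"
  proof -
    have "(1 + B + s) * (1 - B + s) * (4 - (1 + B + s) / 2 - 4 / (1 + B + s))
       = (1 - B + s) * (4 * (1 + B + s) - (1 + B + s) * (1 + B + s) / 2 - 4)"
      using p by (simp add: field_simps)
    also have "\<dots> = 2 * s * (1 + B + s)"
    proof -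
      \<comment> \<open>This relation is the only input: it yields two factorisations whose product
        is the closed form of the denominator.\<close>
      have "s * s = 1 - 6 * B + B * B" using s(3) by (simp add: power2_eq_square)
      hence e1: "8 * (1 + B + s) - (1 + B + s) * (1 + B + s) - 8 = 2 * s * (3 - B - s)"
        and e2: "(1 - B + s) * (3 - B - s) = 2 * (1 + B + s)"
        by (simp_all add: algebra_simps)
      have "(1 - B + s) * (8 * (1 + B + s) - (1 + B + s) * (1 + B + s) - 8) = 2 * s * (2 * (1 + B + s))"
        unfolding e1 e2[symmetric] by (rule mult.left_commute)
      thus ?thesis by (simp add: field_simps)
    qed
    finally show ?thesis .
  qed
  hence "(1 + B + s) * ((1 - B + s) * (4 - (1 + B + s) / 2 - 4 / (1 + B + s))) = (1 + B + s) * (2 * s)"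
    by (simp only: mult.assoc mult.commute[of "1 + B + s" s] mult.left_commute[of "1 + B + s"])
  hence "(1 - B + s) * (4 - (1 + B + s) / 2 - 4 / (1 + B + s)) = 2 * s"
    using p(1) by (simp only: mult_left_cancel less_imp_neq[symmetric] mult_cancel_left) force
  hence "4 - (1 + B + s) / 2 - 4 / (1 + B + s) = t"
    unfolding t_def using p(2) by (subst eq_divide_eq) (auto simp: mult.commute)
  hence den: "4 - exp (-D) - 2 * exp D = t" unfolding e by simp
  have num: "-3 + exp (-D) + 2 * exp D = 1 - t" unfolding den[symmetric] by simp
  have ts: "s \<le> t"
  proof -
    have "s * (1 - B + s) \<le> s * 2" using s assms B by (intro mult_left_mono) auto
    thus ?thesis using p by (simp add: t_def field_simps)
  qed
  have t2: "t \<le> 2" using p s B by (simp add: t_def field_simps)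
  have "\<bar>(1 - t) / t\<bar> \<le> 1 / t" using s ts t2 by (simp add: abs_divide divide_right_mono)
  also have "\<dots> \<le> 1 / s" using s ts by (intro divide_left_mono) auto
  also have "\<dots> \<le> 1 / sqrt (kappa - B)" using s assms by (intro divide_left_mono) auto
  finally show ?thesis unfolding num den .
qed

section \<open>The function under the integral and its Riemann sums\<close>

definition Xend :: real where "Xend = 2 * arcsin (kappa / 2)"

definition integrand :: "real \<Rightarrow> real" where
  "integrand x = ln ((1 + 2 * sin (x / 2) - sqrt (1 - 12 * sin (x / 2) + 4 * (sin (x / 2))\<^sup>2)) / 4)"

lemma Xend_bounds: "0 < Xend" "Xend \<le> pi / 3" "2 * sin (Xend / 2) = kappa"
proof -
  show "2 * sin (Xend / 2) = kappa" using kappa_bounds by (simp add: Xend_def)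
  have "arcsin 0 < arcsin (kappa / 2)" using kappa_bounds by (intro arcsin_less_arcsin) auto
  thus "0 < Xend" by (simp add: Xend_def)
  have "arcsin (kappa / 2) \<le> arcsin (sin (pi / 6))"
    using kappa_bounds by (intro arcsin_le_arcsin) (auto simp: sin_30)
  also have "\<dots> = pi / 6" by (intro arcsin_sin) auto
  finally show "Xend \<le> pi / 3" by (simp add: Xend_def)
qed

lemma chord_bounds:
  assumes "0 < x" "x \<le> Xend"
  shows "0 < 2 * sin (x / 2)" "2 * sin (x / 2) \<le> kappa" "x / 2 \<le> 2 * sin (x / 2)"
proof -
  have x: "x / 2 \<le> pi / 3" using assms Xend_bounds by linarith
  show h: "x / 2 \<le> 2 * sin (x / 2)" using sin_ge_half[of "x / 2"] assms x by linarith
  thus "0 < 2 * sin (x / 2)" using assms by linarith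
  have "sin (x / 2) \<le> sin (Xend / 2)"
    using assms Xend_bounds pi_gt_zero by (intro sin_monotone_2pi_le) linarith+
  thus "2 * sin (x / 2) \<le> kappa" using Xend_bounds by linarith
qed

lemma integrand_eq: "integrand x = ln ((1 + B - sqrt (disc B)) / 4)" if "B = 2 * sin (x / 2)"
  unfolding integrand_def that by (simp add: power2_eq_square)

text \<open>Explains how the two sums of the minorant combine: at x = 2 pi j / n the first summand
  comes from ln |1 - z_j|, the second from pi / a_j.\<close>

lemma integrand_Phi:
  assumes "0 < x" "x \<le> Xend"
  shows "integrand x = ln (2 * sin (x / 2)) + Phi (2 * sin (x / 2))"
proof -
  define B where "B = 2 * sin (x / 2)"
  have B: "0 < B" "B \<le> kappa" using chord_bounds[OF assms] by (auto simp: B_def)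
  have "(1 + B - sqrt (disc B)) / (4 * B) > 0" using Phi_arg[OF B] by (auto intro: divide_pos_pos)
  moreover have "(1 + B - sqrt (disc B)) / 4 = B * ((1 + B - sqrt (disc B)) / (4 * B))" using B by simp
  ultimately show ?thesis
    unfolding integrand_eq[OF B_def] B_def[symmetric] Phi_def using B by (simp only: ln_mult_pos)
qed

text \<open>The lower bound is ln y <= 2 sqrt y applied to y = 2 / x, with 2 sqrt 2 < 3; it supplies
  an integrable majorant with an explicit primitive.\<close>

lemma integrand_bounds:
  assumes "0 \<le> x" "x \<le> Xend"
  shows "integrand x \<le> 0" "- (3 / sqrt x) \<le> integrand x"
proof -
  have "integrand x \<le> 0 \<and> - (3 / sqrt x) \<le> integrand x"
  proof (cases "x = 0")
    \<comment> \<open>At 0 both sides take the default value 0, since \<open>ln 0 = 0\<close> and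
      division by 0 gives 0.\<close>
    case True
    thus ?thesis by (simp add: integrand_def)
  next
    case False
    hence x: "0 < x" using assms by simp
    define B where "B = 2 * sin (x / 2)"
    have B: "0 < B" "B \<le> kappa" "x / 2 \<le> B" using chord_bounds[OF x assms(2)] by (auto simp: B_def)
    note P = exp_Phi[OF B(1,2)]
    have i: "integrand x = ln B + Phi B" using integrand_Phi[OF x assms(2)] by (simp add: B_def)
    have "ln B \<le> B - 1" using B by (intro ln_le_minus_one) auto
    moreover have "Phi B \<le> 1 - B"
    proof -
      have "1 + B \<le> 1 + B + sqrt (disc B)" using disc_bounds[of B] B by simp
      hence "ln 1 \<le> ln (1 + B + sqrt (disc B))" using B by (intro ln_mono) auto
      \<comment> \<open>Comes from ln (sqrt 2) <= sqrt 2 - 1 and kappa = 3 - 2 sqrt 2.\<close>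
      moreover have "ln 2 \<le> 1 - kappa"
      proof -
        have "ln (2::real) = ln ((sqrt 2)^2)" by simp
        also have "\<dots> = 2 * ln (sqrt 2)" by (subst ln_realpow) auto
        also have "\<dots> \<le> 2 * (sqrt 2 - 1)" by (intro mult_left_mono ln_le_minus_one) auto
        also have "\<dots> = 1 - kappa" by (simp add: a_max_kappa(2)) 
        finally show ?thesis .
      qed
      ultimately show ?thesis unfolding P(2) using B(2) by simp
    qed
    moreover have "- (3 / sqrt x) \<le> ln B"
    proof -
      have "ln (sqrt (2 / x)) \<le> sqrt (2 / x) - 1" using x by (intro ln_le_minus_one) auto
      hence "ln (2 / x) \<le> 2 * sqrt (2 / x)" using x by (simp add: ln_sqrt)
      also have "2 * sqrt (2 / x) = 2 * sqrt 2 / sqrt x" by (simp add: real_sqrt_divide)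
      also have "\<dots> \<le> 3 / sqrt x" using kappa_bounds x by (intro divide_right_mono) (auto simp: a_max_kappa)
      finally have "- (3 / sqrt x) \<le> ln (x / 2)" using x by (simp add: ln_div)
      also have "\<dots> \<le> ln B" using x B by (intro ln_mono) auto
      finally show ?thesis .
    qed
    ultimately show ?thesis using P(3) unfolding i by linarith
  qed
  thus "integrand x \<le> 0" "- (3 / sqrt x) \<le> integrand x" by auto
qed

lemma integrand_mono:
  assumes "0 < x" "x \<le> y" "y \<le> Xend"
  shows "integrand x \<le> integrand y"
proof -
  define B C where "B = 2 * sin (x / 2)" and "C = 2 * sin (y / 2)"
  have B: "0 < B" "B \<le> kappa" using chord_bounds[of x] assms by (auto simp: B_def)
  have C: "0 < C" "C \<le> kappa" using chord_bounds[of y] assms by (auto simp: C_def)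
  have "sin (x / 2) \<le> sin (y / 2)"
    using assms Xend_bounds pi_gt_zero by (intro sin_monotone_2pi_le) linarith+
  hence BC: "B \<le> C" by (simp add: B_def C_def)
  have "disc B - disc C = (C - B) * (6 - B - C)" by (simp add: power2_eq_square algebra_simps)
  also have "\<dots> \<ge> 0" using BC B C kappa_bounds by (intro mult_nonneg_nonneg) auto
  finally have "sqrt (disc C) \<le> sqrt (disc B)" by simp
  moreover have "sqrt (disc B) \<le> 1 - B" using disc_bounds[of B] B by simp
  ultimately show ?thesis
    unfolding integrand_eq[OF B_def] integrand_eq[OF C_def] using BC B(1)
    by (intro ln_mono divide_right_mono divide_pos_pos) linarith+
qed

lemma has_integral_inverse_sqrt:
  fixes a c :: real
  assumes "0 \<le> a" "a \<le> c"
  shows "((\<lambda>x. 3 / sqrt x) has_integral (6 * sqrt c - 6 * sqrt a)) {a..c}"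
proof (rule fundamental_theorem_of_calculus_interior[OF assms(2)])
  show "continuous_on {a..c} (\<lambda>x. 6 * sqrt x)" by (intro continuous_intros)
  fix x assume x: "x \<in> {a<..<c}"
  have "((\<lambda>x. 6 * sqrt x) has_real_derivative 3 / sqrt x) (at x)"
    using x assms by (auto intro!: derivative_eq_intros simp: field_simps)
  thus "((\<lambda>x. 6 * sqrt x) has_vector_derivative 3 / sqrt x) (at x)"
    by (simp add: has_real_derivative_iff_has_vector_derivative)
qed

lemma integrand_integrable: "integrand integrable_on {0..Xend}"
proof (rule measurable_bounded_by_integrable_imp_integrable[where g = "\<lambda>x. 3 / sqrt x"])
  have "integrand \<in> borel_measurable lborel" unfolding integrand_def by measurable
  thus "integrand \<in> borel_measurable (lebesgue_on {0..Xend})"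
    by (intro measurable_restrict_space1 measurable_completion)
  show "(\<lambda>x. 3 / sqrt x) integrable_on {0..Xend}"
    using has_integral_inverse_sqrt[of 0 Xend] Xend_bounds by (auto simp: integrable_on_def)
  show "norm (integrand x) \<le> 3 / sqrt x" if "x \<in> {0..Xend}" for x
    using integrand_bounds[of x] that by auto
qed auto

text \<open>Monotonicity squeezes the integral over [h, N h] between left and right sums. What
  remains is h f(h) and the integrals over [0, h] and [N h, b], all controlled by the primitive 6
  sqrt x of the majorant.\<close>

lemma riemann_sum_bound:
  fixes f :: "real \<Rightarrow> real"
  assumes int: "f integrable_on {0..b}"
    and mono: "\<And>x y. 0 < x \<Longrightarrow> x \<le> y \<Longrightarrow> y \<le> b \<Longrightarrow> f x \<le> f y"
    and bd: "\<And>x. 0 \<le> x \<Longrightarrow> x \<le> b \<Longrightarrow> f x \<le> 0 \<and> - (3 / sqrt x) \<le> f x"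
    and h: "0 < h" "1 \<le> N" "real N * h \<le> b"
  shows "\<bar>h * (\<Sum>j=1..N. f (real j * h)) - integral {0..b} f\<bar> \<le> 6 * sqrt h + 6 * sqrt (b - real N * h)"
proof -
  have sub: "f integrable_on {x..y}" if "0 \<le> x" "y \<le> b" for x y
    using int that by (rule_tac integrable_on_subinterval[OF int]) auto
  have ib: "integral {x..y} f \<le> 0 \<and> -(6 * sqrt y - 6 * sqrt x) \<le> integral {x..y} f"
    if "0 \<le> x" "x \<le> y" "y \<le> b" for x y
  proof
    have i: "(f has_integral integral {x..y} f) {x..y}" using sub[of x y] that by (simp add: integrable_integral)
    show "integral {x..y} f \<le> 0"
      using has_integral_le[OF i has_integral_0] bd that by force
    show "-(6 * sqrt y - 6 * sqrt x) \<le> integral {x..y} f"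
      using has_integral_le[OF has_integral_neg[OF has_integral_inverse_sqrt[OF that(1,2)]] i] bd that by force
  qed
  have "h * (\<Sum>j=1..<N. f (real j * h)) \<le> integral {h..real N * h} f \<and>
        integral {h..real N * h} f \<le> h * (\<Sum>j=2..N. f (real j * h))"
    using h(2,3)
  proof (induction N rule: dec_induct)
    case base
    thus ?case by simp
  next
    case (step N)
    have le: "real N * h \<le> real (Suc N) * h" using h by (intro mult_right_mono) auto
    have hN: "h \<le> real N * h" "0 < real N * h" using h(1) step.hyps by auto
    have i: "(f has_integral integral {real N * h..real (Suc N) * h} f) {real N * h..real (Suc N) * h}"
      using sub[of "real N * h"] step.prems h by (simp add: integrable_integral)
    have comb: "integral {h..real (Suc N) * h} f = integral {h..real N * h} f + integral {real N * h..real (Suc N) * h} f"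
      using sub[of h "real (Suc N) * h"] le hN h step.prems
      by (intro Henstock_Kurzweil_Integration.integral_combine[symmetric]) auto
    have c: "((\<lambda>x. k) has_integral h * k) {real N * h..real (Suc N) * h}" for k :: real
      using has_integral_const_real[of k "real N * h" "real (Suc N) * h"] le by (simp add: algebra_simps)
    have "integral {real N * h..real (Suc N) * h} f \<le> h * f (real (Suc N) * h)"
    proof (rule has_integral_le[OF i c])
      fix x assume x: "x \<in> {real N * h..real (Suc N) * h}"
      hence "0 < x" using less_le_trans[OF hN(2)] by auto
      thus "f x \<le> f (real (Suc N) * h)" using x step.prems by (intro mono) auto
    qed
    moreover have "h * f (real N * h) \<le> integral {real N * h..real (Suc N) * h} f"
    proof (rule has_integral_le[OF c i])
      fix x assume x: "x \<in> {real N * h..real (Suc N) * h}"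
      hence "0 < x" using less_le_trans[OF hN(2)] by auto
      show "f (real N * h) \<le> f x" using x hN(2) step.prems by (intro mono) auto
    qed
    moreover have "h * (\<Sum>j=1..<N. f (real j * h)) \<le> integral {h..real N * h} f \<and>
        integral {h..real N * h} f \<le> h * (\<Sum>j=2..N. f (real j * h))"
      using step.IH step.prems le by linarith
    moreover have "(\<Sum>j=1..<Suc N. f (real j * h)) = (\<Sum>j=1..<N. f (real j * h)) + f (real N * h)"
      using step.hyps by simp
    moreover have "(\<Sum>j=2..Suc N. f (real j * h)) = (\<Sum>j=2..N. f (real j * h)) + f (real (Suc N) * h)"
      using step.hyps by (subst sum.nat_ivl_Suc') auto
    ultimately show ?case unfolding comb by (simp add: distrib_left del: of_nat_Suc)
  qed
  moreover have "h * (\<Sum>j=1..N. f (real j * h)) = h * (\<Sum>j=1..<N. f (real j * h)) + h * f (real N * h)"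
    using h(2) unfolding distrib_left[symmetric]
    by (cases N) (auto simp: atLeastLessThanSuc_atLeastAtMost)
  moreover have "h * (\<Sum>j=1..N. f (real j * h)) = h * f h + h * (\<Sum>j=2..N. f (real j * h))"
    using h(2) unfolding distrib_left[symmetric]
    by (subst sum.atLeast_Suc_atMost) (auto simp: numeral_2_eq_2)
  moreover have hb: "h \<le> real N * h" "0 \<le> real N * h" using h by auto
  have "h * f (real N * h) \<le> 0" using bd[of "real N * h"] h hb by (simp add: mult_le_0_iff)
  moreover have "h * f h \<ge> - (3 * sqrt h)"
  proof -
    have "- (3 / sqrt h) \<le> f h" using bd[of h] hb h by simp
    hence "h * (- (3 / sqrt h)) \<le> h * f h" using h by (intro mult_left_mono) auto
    moreover have "h * (- (3 / sqrt h)) = - (3 * sqrt h)" using h real_sqrt_mult_self[of h] by (simp add: field_simps)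
    ultimately show ?thesis by linarith
  qed
  moreover have "integral {0..b} f = integral {0..h} f + integral {h..real N * h} f + integral {real N * h..b} f"
    using Henstock_Kurzweil_Integration.integral_combine[of 0 h b f] h hb int sub[of h b]
      Henstock_Kurzweil_Integration.integral_combine[of h "real N * h" b f] by simp
  moreover have "integral {0..h} f \<le> 0" "-(6 * sqrt h) \<le> integral {0..h} f"
    "integral {real N * h..b} f \<le> 0" "-(6 * sqrt b - 6 * sqrt (real N * h)) \<le> integral {real N * h..b} f"
    using ib[of 0 h] ib[of "real N * h" b] h hb by auto
  moreover have "sqrt b \<le> sqrt (real N * h) + sqrt (b - real N * h)"
    using sqrt_add_le_add_sqrt[of "real N * h" "b - real N * h"] h hb by simp
  moreover have "sqrt h \<ge> 0" using h by simp
  ultimately show ?thesis unfolding abs_le_iff by linarith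
qed

subsection \<open>The terms of the minorant\<close>

text \<open>The two-sided error between |1 - z_j| and \<open>node n j\<close>.\<close>

definition delta :: "nat \<Rightarrow> real" where "delta n = (ln n + 2) / n"

text \<open>Since 17/100 < kappa, the second condition puts j = 1 into the set whose maximum is
  \<open>J_max n\<close>, so that this maximum is meaningful.\<close>

definition large :: "nat \<Rightarrow> bool" where
  "large n \<longleftrightarrow> n \<ge> 100 \<and> 2 * pi / n + 2 * delta n \<le> 17 / 100"

text \<open>J is pinned from both sides: its membership in the defining set yields the third claim
  through the one-sided root estimate, and the failure of J + 1 yields the fourth through the
  two-sided one.\<close>

lemma J_max_props:
  assumes "large n"
  defines "J \<equiv> J_max n"
  shows "1 \<le> J" "Suc J \<le> n div 6" "2 * sin ((pi * J - pi / 4) / n) \<le> kappa"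
    "Xend - angle_upper n (Suc J) \<le> 4 * delta n"
proof -
  have n: "n \<ge> 100" "2 * pi / n + 2 * delta n \<le> 17 / 100" using assms by (auto simp: large_def)
  have "ln (real n) \<ge> 0" using n by simp
  hence d0: "delta n \<ge> 0" "ln n / n \<le> delta n" using n by (auto simp: delta_def divide_right_mono)
  define S where "S = {j \<in> {1..n div 6}. cmod (-1 + zroot n j) / cmod (zroot n j) \<le> kappa}"
  \<comment> \<open>One \<open>delta n\<close> pays for replacing |1 - z_j| by the node, the other
    for the factor |z_j| >= 1 - \<open>delta n\<close>.\<close>
  have inS: "j \<in> S" if "1 \<le> j" "j \<le> n div 6" "node n j \<le> kappa - 2 * delta n" for j
  proof -
    note z = zroot_estimates[OF that(1,2)]
    have "cmod (1 - zroot n j) \<le> node n j + delta n" using z(7) unfolding delta_def[symmetric] by (simp add: abs_le_iff)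
    also have "\<dots> \<le> kappa - 1 * delta n" using that by simp
    also have "\<dots> \<le> kappa - kappa * delta n" using d0 kappa_bounds by (intro diff_left_mono mult_right_mono) auto
    also have "\<dots> = kappa * (1 - delta n)" by (simp add: algebra_simps)
    also have "\<dots> \<le> kappa * cmod (zroot n j)" using z(6) d0 kappa_bounds by (intro mult_left_mono) auto
    finally have "cmod (-1 + zroot n j) \<le> kappa * cmod (zroot n j)" by (simp add: norm_minus_commute)
    thus ?thesis using that z(1) by (simp add: S_def divide_le_eq)
  qed
  have "node n 1 \<le> 2 * pi / n" using sin_x_le_x[of "pi / n"] by simp
  hence "1 \<in> S" using inS[of 1] n kappa_bounds by auto
  moreover have fin: "finite S" by (simp add: S_def)
  moreover have JS: "J = Max S" by (simp add: J_def J_max_def S_def)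
  ultimately have "J \<in> S" using Max_in[of S] by blast
  hence J: "1 \<le> J" "J \<le> n div 6" "cmod (-1 + zroot n J) / cmod (zroot n J) \<le> kappa" by (auto simp: S_def)
  show "1 \<le> J" by fact
  show s: "2 * sin ((pi * J - pi / 4) / n) \<le> kappa"
    using zroot_estimates(8)[OF J(1,2)] J(3) by linarith
  \<comment> \<open>If J were n div 6, the half-angle \<open>y\<close> would be at least 2/5, and 2
    sin y >= 2/5 exceeds kappa. So J + 1 is still a valid index, and maximality says something about
    it.\<close>
  show SJ: "Suc J \<le> n div 6"
  proof (rule ccontr)
    assume "\<not> Suc J \<le> n div 6"
    hence "J = n div 6" using J by simp
    hence J6: "real n \<le> 6 * real J + 5" "6 * real J \<le> real n" by linarith+
    define y where "y = (pi * J - pi / 4) / n"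
    have "2 / 5 * real n \<le> 3 * real J - 1" using J6 n by simp
    also have "\<dots> \<le> pi * J - pi / 4"
    proof -
      have "3 * (real J - 1/4) \<le> pi * (real J - 1/4)" using pi_gt3 J by (intro mult_right_mono) auto
      thus ?thesis by (simp add: algebra_simps)
    qed
    finally have y1: "2 / 5 \<le> y" using n(1) by (simp add: y_def pos_le_divide_eq)
    have "pi * (6 * real J) \<le> pi * real n" using J6 by (intro mult_left_mono) auto
    moreover have "0 \<le> pi * real n" by simp
    ultimately have "pi * J - pi / 4 \<le> pi / 3 * real n" using pi_gt_zero by linarith
    hence y2: "y \<le> pi / 3" using n(1) by (simp add: y_def pos_divide_le_eq)
    have "y / 2 \<le> sin y" using y1 y2 by (intro sin_ge_half) auto
    thus False using s y1 kappa_bounds unfolding y_def[symmetric] by linarith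
  qed
  have "Suc J \<notin> S" using Max_ge[OF fin, of "Suc J"] JS by auto
  hence nd: "node n (Suc J) > kappa - 2 * delta n" using inS[of "Suc J"] SJ by fastforce
  show "Xend - angle_upper n (Suc J) \<le> 4 * delta n"
  proof (cases "angle_upper n (Suc J) < Xend")
    case False
    thus ?thesis using d0 by simp
  next
    case True
    define t where "t = angle_upper n (Suc J)"
    have t: "0 \<le> t" "t < Xend" using True by (auto simp: t_def)
    have "(Xend / 2 - t / 2) / 2 \<le> sin (Xend / 2) - sin (t / 2)"
      using t Xend_bounds by (intro sin_diff_ge) auto
    hence "Xend - t \<le> 2 * (2 * sin (Xend / 2) - 2 * sin (t / 2))" by (simp add: field_simps)
    moreover have "node n (Suc J) = 2 * sin (t / 2)" by (simp add: t_def)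
    with nd have "kappa - 2 * delta n < 2 * sin (t / 2)" by (simp only:)
    ultimately show ?thesis unfolding Xend_bounds(3) t_def[symmetric] by argo
  qed
qed

text \<open>The half-angles a = pi j / n and b = (pi J - pi / 4) / n differ by at least 3 pi / (4 n)
  > 9 / (4 n), while 2 sin b <= kappa and 2 sin grows at rate at least 1 on this range.\<close>

lemma node_below_kappa:
  assumes "large n" "1 \<le> j" "j < J_max n"
  shows "node n j \<le> kappa - 2 / n"
proof -
  define J where "J = J_max n"
  note P = J_max_props[OF assms(1), folded J_def]
  have n: "real n \<ge> 100" using assms by (simp add: large_def)
  have jJ: "real j + 1 \<le> real J" using assms by (simp add: J_def)
  define a b where "a = pi * j / n" and "b = (pi * J - pi / 4) / n"
  have "pi * (real j + 1) \<le> pi * J" using jJ by (intro mult_left_mono) auto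
  hence "9 / 4 \<le> (pi * J - pi / 4) - pi * j" using pi_gt3 unfolding distrib_left by linarith
  hence "9 / 4 / n \<le> ((pi * J - pi / 4) - pi * j) / n" using n by (intro divide_right_mono) auto
  hence ab: "9 / 4 / n \<le> b - a" by (simp add: a_def b_def diff_divide_distrib)
  have "6 * real J \<le> real n" using P(2) by linarith
  hence "pi * (6 * real J) \<le> pi * real n" by (intro mult_left_mono) auto
  moreover have "0 \<le> pi * real n" by simp
  ultimately have "pi * J - pi / 4 \<le> pi / 3 * real n" using pi_gt_zero by linarith
  hence b: "b \<le> pi / 3" using n by (simp add: b_def field_simps)
  have "2 / real n \<le> 9 / 4 / n" using n by (intro divide_right_mono) auto
  moreover have "0 < 2 / real n" using n by simp
  ultimately have "a \<le> b" using ab by linarith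
  moreover have "0 \<le> a" by (simp add: a_def)
  ultimately have "(b - a) / 2 \<le> sin b - sin a" using b by (intro sin_diff_ge)
  hence "2 * sin a \<le> 2 * sin b - (b - a)" by (simp add: field_simps)
  also have "\<dots> \<le> kappa - 2 / n"
    using P(3) order_trans[OF \<open>2 / real n \<le> 9 / 4 / n\<close> ab] unfolding b_def[symmetric]
    by (intro diff_mono)
  finally show ?thesis unfolding a_def .
qed

text \<open>B exceeds the node x by -x ln x / n, which lies in [0, 1 / n]; half of the margin 2 / n
  below kappa survives.\<close>

lemma B_coef_bounds:
  assumes "large n" "1 \<le> j" "j < J_max n"
  shows "node n j \<le> B_coef n j" "B_coef n j \<le> node n j + 1 / n" "B_coef n j \<le> kappa - 1 / n"
proof -
  define x where "x = node n j"
  have n: "real n \<ge> 100" using assms by (simp add: large_def)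
  have j6: "j \<le> n div 6" using J_max_props[OF assms(1)] assms by simp
  have x: "0 < x" "x \<le> 1" using node_ge[OF assms(2) j6] by (auto simp: x_def)
  have B: "B_coef n j = x + x * (- ln x) / n" by (simp add: B_coef_def x_def[symmetric] algebra_simps)
  have "0 \<le> x * (- ln x) / n" using x by (intro divide_nonneg_nonneg mult_nonneg_nonneg) auto
  thus "node n j \<le> B_coef n j" unfolding B x_def[symmetric] by linarith
  have "ln (1 / x) \<le> 1 / x - 1" using x by (intro ln_le_minus_one) auto
  hence "x * (- ln x) \<le> x * (1 / x - 1)" using x by (intro mult_left_mono) (auto simp: ln_div)
  also have "\<dots> \<le> 1" using x by (simp add: algebra_simps)
  finally have "x * (- ln x) / n \<le> 1 / n" by (intro divide_right_mono) auto
  thus *: "B_coef n j \<le> node n j + 1 / n" unfolding B x_def[symmetric] by simp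
  have "2 / real n = 1 / n + 1 / n" by simp
  thus "B_coef n j \<le> kappa - 1 / n" using * node_below_kappa[OF assms] by linarith
qed

text \<open>\<open>Y\<close> is pi / a_j. Its correction term is at most (2 / n) (n / (2 j)) sqrt n
  = sqrt n / j, from B >= 2 j / n, kappa - B >= 1 / n and the log log factor being at most 1.
  Passing from B to the node costs 4 / sqrt n.\<close>

lemma second_sum_term:
  assumes "large n" "1 \<le> j" "j < J_max n"
  shows "\<bar>n * ln (1 + pi / (n * a_coef n j)) - Phi (node n j)\<bar> \<le> 24 / sqrt n + 5 * sqrt n / j"
proof -
  have n: "real n \<ge> 100" using assms by (simp add: large_def)
  have j6: "j \<le> n div 6" using J_max_props[OF assms(1)] assms by simp
  note nb = node_ge[OF assms(2) j6] and B = B_coef_bounds[OF assms] and nk = node_below_kappa[OF assms]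
  define b where "b = B_coef n j"
  define Q where "Q = (-3 + exp (- Phi b) + 2 * exp (Phi b)) / (4 - exp (- Phi b) - 2 * exp (Phi b))"
  define l where "l = (ln (ln (real n)) / ln (real n))\<^sup>2"
  define Y where "Y = Phi b + 2 / n * inverse b * Q * l"
  define s where "s = sqrt n"
  have s: "s \<ge> 10" "s * s = n" using n by (auto simp: s_def real_le_rsqrt)
  have j: "real j \<ge> 1" using assms by simp
  have n1: "1 / real n > 0" "2 / real n > 0" using n by auto
  have nk': "node n j \<le> kappa" using nk n1 by linarith
  have b: "0 < b" "b < kappa" "1 / n \<le> kappa - b" using B nb n1 unfolding b_def by linarith+
  have ac: "pi / (n * a_coef n j) = Y / n"
  proof -
    have "a_coef n j = pi / Y"
      using assms(3) by (simp add: a_coef_def Y_def Q_def l_def b_def D_coef_def Phi_def)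
    thus ?thesis by simp
  qed
  have "ln (real n) \<ge> 1" using n exp_le by (subst ln_ge_iff) auto
  hence l: "0 \<le> l" "l \<le> 1"
  proof -
    assume l1: "ln (real n) \<ge> 1"
    have "ln (ln (real n)) \<le> ln (real n) - 1" using l1 by (intro ln_le_minus_one) auto
    moreover have "0 \<le> ln (ln (real n))" using l1 by simp
    ultimately have "0 \<le> ln (ln (real n)) / ln (real n)" "ln (ln (real n)) / ln (real n) \<le> 1"
      using l1 by (auto simp: divide_le_eq)
    thus "0 \<le> l" "l \<le> 1" unfolding l_def by (auto intro: power_le_one)
  qed
  have "\<bar>Q\<bar> \<le> 1 / sqrt (kappa - b)" unfolding Q_def using b by (intro perturbation_bound) auto
  also have "\<dots> \<le> 1 / sqrt (1 / n)" using b n by (intro divide_left_mono) auto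
  also have "\<dots> = s" by (simp add: s_def real_sqrt_divide)
  finally have Q: "\<bar>Q\<bar> \<le> s" .
  have "2 * real j / n \<le> b" using B(1) nb(1) unfolding b_def by linarith
  hence "inverse b \<le> inverse (2 * real j / n)" using j n by (intro le_imp_inverse_le) auto
  hence ib: "0 < inverse b" "inverse b \<le> n / (2 * j)" using b by auto
  have "\<bar>2 / n * inverse b * Q * l\<bar> = 2 / n * inverse b * \<bar>Q\<bar> * l" using ib l by (simp add: abs_mult)
  also have "\<dots> \<le> 2 / n * (n / (2 * j)) * s * 1"
    using ib l Q s by (intro mult_mono) auto
  also have "\<dots> = s / j" using n by simp
  finally have p1: "\<bar>Y - Phi b\<bar> \<le> s / j" by (simp add: Y_def)
  have "\<bar>Phi b - Phi (node n j)\<bar> \<le> \<bar>b - node n j\<bar> + sqrt (6 * \<bar>b - node n j\<bar>)"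
    using b(1,2) nb(3) nk' by (intro Phi_diff_le) auto
  also have "\<dots> \<le> 1 / n + sqrt (6 * (1 / n))"
    using B unfolding b_def by (intro add_mono real_sqrt_le_mono) auto
  also have "\<dots> \<le> 1 / s + 3 / s"
  proof (rule add_mono)
    have "s * 1 \<le> s * s" using s by (intro mult_left_mono) auto
    thus "1 / real n \<le> 1 / s" using s n by (intro divide_left_mono) auto
    have "sqrt 6 \<le> 3" by (rule real_le_lsqrt) auto
    thus "sqrt (6 * (1 / real n)) \<le> 3 / s" using s by (simp add: real_sqrt_divide s_def[symmetric] divide_right_mono)
  qed
  finally have p2: "\<bar>Phi b - Phi (node n j)\<bar> \<le> 4 / s" by simp
  have Y1: "\<bar>Y - Phi (node n j)\<bar> \<le> s / j + 4 / s" using p1 p2 by linarith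
  have Pn: "0 \<le> Phi (node n j)" "Phi (node n j) \<le> 1" using exp_Phi(3,4)[OF nb(3) nk'] by auto
  have "4 / s \<le> 4 / 10" using s by (intro divide_left_mono) auto
  hence Y2: "\<bar>Y\<bar> \<le> 5 + s / j" using Y1 Pn by linarith
  have "s / j \<le> s / 1" using j s by (intro divide_left_mono) auto
  hence Y3: "\<bar>Y\<bar> \<le> 2 * s" using Y2 s by linarith
  have Yn: "\<bar>Y / n\<bar> \<le> 1 / 2"
  proof -
    have "2 * s \<le> n / 2" using s mult_right_mono[of 4 s s] by simp
    thus ?thesis using Y3 n by (simp add: field_simps)
  qed
  have "\<bar>ln (1 + Y / n) - Y / n\<bar> \<le> 2 * (Y / n)\<^sup>2" by (rule abs_ln_one_plus_x_minus_x_bound[OF Yn])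
  hence "n * \<bar>ln (1 + Y / n) - Y / n\<bar> \<le> n * (2 * (Y / n)\<^sup>2)" by (intro mult_left_mono) auto
  also have "n * \<bar>ln (1 + Y / n) - Y / n\<bar> = \<bar>n * ln (1 + Y / n) - Y\<bar>"
  proof -
    have "n * ln (1 + Y / n) - Y = n * (ln (1 + Y / n) - Y / n)" using n by (simp add: algebra_simps)
    thus ?thesis by (simp add: abs_mult)
  qed
  also have "n * (2 * (Y / n)\<^sup>2) = 2 * (\<bar>Y\<bar> * \<bar>Y\<bar>) / n" using n by (simp add: power2_eq_square)
  \<comment> \<open>The two factors |Y| are bounded differently, so that the sum over j stays of
    order sqrt n ln n.\<close>
  also have "\<dots> \<le> 2 * ((5 + s / j) * (2 * s)) / n"
    using Y2 Y3 s j by (intro divide_right_mono mult_left_mono mult_mono) auto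
  also have "\<dots> = 20 / s + 4 / j"
  proof -
    have "2 * ((5 + s / j) * (2 * s)) / (s * s) = 4 * (5 + s / j) / s" using s(1) by simp
    also have "\<dots> = 20 / s + 4 * (s / j) / s" by (simp add: add_divide_distrib distrib_left)
    also have "\<dots> = 20 / s + 4 / j" using s(1) by simp
    finally show ?thesis by (simp only: s(2))
  qed
  also have "\<dots> \<le> 20 / s + 4 * s / j" using s j by (intro add_left_mono divide_right_mono) auto
  finally have "\<bar>n * ln (1 + Y / n) - Y\<bar> \<le> 20 / s + 4 * s / j" .
  hence "\<bar>n * ln (1 + Y / n) - Phi (node n j)\<bar> \<le> (20 / s + 4 * s / j) + (s / j + 4 / s)" using Y1 by linarith
  also have "\<dots> = 24 / s + 5 * s / j"
    by (simp add: add_divide_distrib[symmetric] add.commute add.left_commute)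
  finally show ?thesis unfolding ac s_def .
qed

lemma sum_inverse_le: "(\<Sum>j=1..N. 1 / real j) \<le> 1 + ln N" if "N \<ge> 1"
  using that
proof (induction N rule: dec_induct)
  case base
  show ?case by simp
next
  case (step N)
  have "ln (real N / real (Suc N)) \<le> real N / real (Suc N) - 1" using step by (intro ln_le_minus_one) auto
  also have "\<dots> = - (1 / real (Suc N))" by (simp add: field_simps)
  finally have "1 / real (Suc N) \<le> ln (real (Suc N)) - ln N" using step by (simp add: ln_div del: of_nat_Suc)
  thus ?case using step by simp
qed

subsection \<open>The asymptotic expansion\<close>

text \<open>The minorant without log house; it sees the algebraic number only through n.\<close>

definition K_r :: "(nat \<Rightarrow> real) \<Rightarrow> nat \<Rightarrow> real" where
  "K_r v n = - 2 * (\<Sum>j = 1..J_max n. ln (cmod (zroot n j)))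
        - 2 * (\<Sum>j = 1..nat \<lfloor>v n\<rfloor>. ln (1 + pi / (real n * a_max)))
        - 2 * (\<Sum>j = nat \<lceil>v n\<rceil>..J_max n. ln (1 + pi / (real n * a_coef n j)))"

lemma L_r_eq: "L_r v \<alpha> = ln (house \<alpha>) + K_r v (dyg (house \<alpha>))"
  by (simp add: L_r_def K_r_def Let_def)

lemma sum_inverse_le_ln: "(\<Sum>j=1..N. 1 / real j) \<le> 1 + ln (real n)" if "N \<le> n" "1 \<le> n"
proof (cases "N = 0")
  case False
  hence "(\<Sum>j=1..N. 1 / real j) \<le> 1 + ln N" by (intro sum_inverse_le) auto
  also have "\<dots> \<le> 1 + ln (real n)" using False that by simp
  finally show ?thesis .
qed (use that in auto)

text \<open>The error \<open>delta n\<close> relative to the lower bound 2 j / n leaves a harmonic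
  sum. The term j = J is split off, because only for j < J is the node known to lie below
  kappa.\<close>

lemma first_sum_bound:
  assumes "large n"
  shows "\<bar>n * (\<Sum>j=1..J_max n. ln (cmod (zroot n j))) - (\<Sum>j=1..J_max n - 1. ln (node n j))\<bar>
           \<le> (ln n + 2) * (1 + ln n) + ln n"
proof -
  define J where "J = J_max n"
  note P = J_max_props[OF assms, folded J_def]
  have n: "real n \<ge> 100" using assms by (simp add: large_def)
  define w where "w = (\<lambda>j. ln (cmod (1 - zroot n j)))"
  have ln0: "ln (real n) \<ge> 0" using n by simp
  have w: "n * ln (cmod (zroot n j)) = w j" if "j \<in> {1..J}" for j
    using zroot_estimates(3)[of j n] that P n by (simp add: w_def)
  have "n * (\<Sum>j=1..J. ln (cmod (zroot n j))) = (\<Sum>j=1..J. w j)"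
    unfolding sum_distrib_left by (intro sum.cong refl w)
  also have "\<dots> = (\<Sum>j=1..J-1. w j) + w J"
    using P(1) by (cases J) auto
  finally have e: "n * (\<Sum>j=1..J. ln (cmod (zroot n j))) - (\<Sum>j=1..J-1. ln (node n j))
     = (\<Sum>j=1..J-1. w j - ln (node n j)) + w J" by (simp add: sum_subtractf)
  have t: "\<bar>w j - ln (node n j)\<bar> \<le> (ln n + 2) * (1 / j)" if "j \<in> {1..J-1}" for j
  proof -
    have j: "1 \<le> j" "j \<le> n div 6" using that P by auto
    have "\<bar>w j - ln (node n j)\<bar> \<le> \<bar>cmod (1 - zroot n j) - node n j\<bar> / (2 * real j / n)"
      unfolding w_def using zroot_estimates(4)[OF j] node_ge(1)[OF j] j n
      by (intro abs_ln_diff_le) auto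
    also have "\<dots> \<le> ((ln n + 2) / n) / (2 * real j / n)"
      using zroot_estimates(7)[OF j] by (intro divide_right_mono) auto
    also have "\<dots> = (ln n + 2) / (2 * real j)" using n by simp
    also have "\<dots> \<le> (ln n + 2) / (1 * real j)" using ln0 j by (intro divide_left_mono) auto
    finally show ?thesis by simp
  qed
  have "\<bar>\<Sum>j=1..J-1. w j - ln (node n j)\<bar> \<le> (\<Sum>j=1..J-1. (ln n + 2) * (1 / j))"
    using t by (intro order_trans[OF sum_abs] sum_mono)
  also have "\<dots> = (ln n + 2) * (\<Sum>j=1..J-1. 1 / j)" by (simp only: sum_distrib_left)
  also have "\<dots> \<le> (ln n + 2) * (1 + ln n)"
  proof (rule mult_left_mono)
    have "J - 1 \<le> n" "1 \<le> n" using P(2) n by linarith+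
    thus "(\<Sum>j=1..J-1. 1 / real j) \<le> 1 + ln n" by (rule sum_inverse_le_ln)
  qed (use ln0 in auto)
  finally have 1: "\<bar>\<Sum>j=1..J-1. w j - ln (node n j)\<bar> \<le> (ln n + 2) * (1 + ln n)" .
  have J6: "1 \<le> J" "J \<le> n div 6" using P by auto
  have "1 / real n \<le> 2 * real J / n" using J6 by (intro divide_right_mono) auto
  hence c: "1 / real n \<le> cmod (1 - zroot n J)" using zroot_estimates(4)[OF J6] by linarith
  hence "ln (1 / real n) \<le> w J" unfolding w_def using n by (intro ln_mono) auto
  moreover have "0 < cmod (1 - zroot n J)" using c n by (intro less_le_trans[OF _ c]) auto
  hence "w J \<le> 0" unfolding w_def using zroot_estimates(5)[OF J6] by simp
  ultimately have "\<bar>w J\<bar> \<le> ln n" using n by (simp add: ln_div)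
  thus ?thesis using 1 e unfolding J_def by linarith
qed

text \<open>Extending the sum down to j = 1 adds fewer than \<open>m\<close> terms in [0, 1]. The
  term j = J, where \<open>a_coef\<close> is \<open>a_max\<close>, contributes at most pi /
  a_max.\<close>

lemma second_sum_bound:
  assumes "large n" "1 \<le> m" "m \<le> J_max n"
  shows "\<bar>n * (\<Sum>j=m..J_max n. ln (1 + pi / (n * a_coef n j))) - (\<Sum>j=1..J_max n - 1. Phi (node n j))\<bar>
           \<le> m + 24 * sqrt n + 5 * sqrt n * (1 + ln n) + pi / a_max"
proof -
  define J where "J = J_max n"
  note P = J_max_props[OF assms(1), folded J_def]
  have n: "real n \<ge> 100" using assms by (simp add: large_def)
  define Y where "Y = (\<lambda>j. n * ln (1 + pi / (n * a_coef n j)))"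
  have Jn: "J - 1 \<le> n" "1 \<le> n" using P(2) n by linarith+
  have s: "sqrt n * sqrt n = n" "sqrt n > 0" using n by auto
  have PB: "0 \<le> Phi (node n j) \<and> Phi (node n j) \<le> 1" if "j \<in> {1..J-1}" for j
  proof -
    have "1 \<le> j" "j < J_max n" "j \<le> n div 6" using that P by (auto simp: J_def)
    moreover have "node n j \<le> kappa"
      using node_below_kappa[OF assms(1) \<open>1 \<le> j\<close> \<open>j < J_max n\<close>] n
      by (smt (verit, best) divide_nonneg_nonneg)
    ultimately show ?thesis using exp_Phi(3,4)[of "node n j"] node_ge(3)[of j n] by auto
  qed
  have "n * (\<Sum>j=m..J. ln (1 + pi / (n * a_coef n j))) = (\<Sum>j=m..J. Y j)"
    by (simp add: sum_distrib_left Y_def)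
  also have "\<dots> = (\<Sum>j=m..J-1. Y j) + Y J"
    using P(1) assms(3) unfolding J_def[symmetric] by (cases J) auto
  finally have e1: "n * (\<Sum>j=m..J. ln (1 + pi / (n * a_coef n j))) = (\<Sum>j=m..J-1. Y j) + Y J" .
  have "{1..J-1} = {1..<m} \<union> {m..J-1}" "{1..<m} \<inter> {m..J-1} = {}"
    using assms(2,3) unfolding J_def[symmetric] by auto
  hence e2: "(\<Sum>j=1..J-1. Phi (node n j)) = (\<Sum>j=1..<m. Phi (node n j)) + (\<Sum>j=m..J-1. Phi (node n j))"
    by (simp add: sum.union_disjoint)
  have sub: "{1..<m} \<subseteq> {1..J-1}" using assms(3) unfolding J_def[symmetric] by auto
  have "(\<Sum>j=1..<m. Phi (node n j)) \<le> (\<Sum>j=1..<m. 1)" using PB sub by (intro sum_mono) blast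
  also have "\<dots> \<le> m" by simp
  finally have b1: "(\<Sum>j=1..<m. Phi (node n j)) \<le> m" .
  have b0: "0 \<le> (\<Sum>j=1..<m. Phi (node n j))" using PB sub by (intro sum_nonneg) blast
  have "\<bar>\<Sum>j=m..J-1. Y j - Phi (node n j)\<bar> \<le> (\<Sum>j=m..J-1. 24 / sqrt n + 5 * sqrt n / j)"
  proof (intro order_trans[OF sum_abs] sum_mono)
    fix j assume "j \<in> {m..J-1}"
    hence "1 \<le> j" "j < J_max n" using assms(2) P(1) unfolding J_def[symmetric] by auto
    thus "\<bar>Y j - Phi (node n j)\<bar> \<le> 24 / sqrt n + 5 * sqrt n / j"
      unfolding Y_def by (rule second_sum_term[OF assms(1)])
  qed
  also have "\<dots> \<le> (\<Sum>j=1..J-1. 24 / sqrt n + 5 * sqrt n / j)"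
    using assms(2) by (intro sum_mono2) (auto intro!: add_nonneg_nonneg)
  also have "\<dots> = real (J - 1) * (24 / sqrt n) + 5 * sqrt n * (\<Sum>j=1..J-1. 1 / j)"
    by (simp add: sum.distrib sum_distrib_left)
  also have "\<dots> \<le> real n * (24 / sqrt n) + 5 * sqrt n * (1 + ln n)"
    using Jn s by (intro add_mono mult_right_mono mult_left_mono sum_inverse_le_ln) auto
  also have "real n * (24 / sqrt n) = 24 * sqrt n" using s by (simp add: field_simps)
  finally have b2: "\<bar>\<Sum>j=m..J-1. Y j - Phi (node n j)\<bar> \<le> 24 * sqrt n + 5 * sqrt n * (1 + ln n)" .
  have b3: "0 \<le> Y J \<and> Y J \<le> pi / a_max"
  proof -
    have YJ: "Y J = n * ln (1 + pi / (n * a_max))" by (simp add: Y_def J_def a_coef_def)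
    have p: "pi / (n * a_max) \<ge> 0" using a_max_kappa n by (intro divide_nonneg_nonneg) auto
    have "n * ln (1 + pi / (n * a_max)) \<le> n * (pi / (n * a_max))"
      using p by (intro mult_left_mono ln_add_one_self_le_self) auto
    also have "\<dots> = pi / a_max" using n by simp
    finally show ?thesis unfolding YJ using p n by auto
  qed
  have "n * (\<Sum>j=m..J. ln (1 + pi / (n * a_coef n j))) - (\<Sum>j=1..J-1. Phi (node n j))
     = (\<Sum>j=m..J-1. Y j - Phi (node n j)) + Y J - (\<Sum>j=1..<m. Phi (node n j))"
    unfolding e1 e2 by (simp add: sum_subtractf)
  thus ?thesis using b0 b1 b2 b3 unfolding J_def[symmetric] by linarith
qed

lemma riemann_bound:
  assumes "large n" "J_max n \<ge> 2"
  shows "\<bar>2 * pi / n * (\<Sum>j=1..J_max n - 1. ln (node n j) + Phi (node n j)) - integral {0..Xend} integrand\<bar>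
     \<le> 6 * sqrt (2 * pi / n) + 6 * sqrt (4 * delta n + 2 * (2 * pi / n))"
proof -
  define J where "J = J_max n"
  define h where "h = 2 * pi / n"
  note P = J_max_props[OF assms(1), folded J_def]
  have n: "real n \<ge> 100" using assms by (simp add: large_def)
  have h: "h > 0" using n by (simp add: h_def)
  have Jr: "real (J - 1) = real J - 1" using P by simp
  have le: "real (J - 1) * h \<le> Xend"
  proof (rule ccontr)
    assume a: "\<not> real (J - 1) * h \<le> Xend"
    define t where "t = real (J - 1) * h / 2"
    have J1: "1 \<le> J - 1" "J - 1 < J_max n" "J - 1 \<le> n div 6" using assms P by (auto simp: J_def)
    have t: "t = pi * real (J - 1) / n" by (simp add: t_def h_def)
    have "angle_upper n (J - 1) / 2 = t" by (simp add: t)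
    hence "t \<le> pi / 3 / 2" using divide_right_mono[OF angles(4)[OF J1(1,3)], of 2] by simp
    hence "t \<le> pi / 3" using pi_gt_zero by linarith
    moreover have "Xend / 2 \<le> t" "- (pi / 2) \<le> Xend / 2" using a Xend_bounds(1) pi_gt_zero unfolding t_def by linarith+
    ultimately have "sin (Xend / 2) \<le> sin t"
      using pi_gt_zero by (intro sin_monotone_2pi_le) linarith+
    moreover have "2 * sin t \<le> kappa - 2 / n" using node_below_kappa[OF assms(1) J1(1,2)] unfolding t .
    moreover have "2 / real n > 0" using n by simp
    ultimately show False using Xend_bounds(3) by linarith
  qed
  have "\<bar>h * (\<Sum>j=1..J-1. integrand (real j * h)) - integral {0..Xend} integrand\<bar>
     \<le> 6 * sqrt h + 6 * sqrt (Xend - real (J - 1) * h)"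
    using assms(2) le h integrand_bounds
    by (intro riemann_sum_bound integrand_integrable integrand_mono) (auto simp: J_def)
  also have "(\<Sum>j=1..J-1. integrand (real j * h)) = (\<Sum>j=1..J-1. ln (node n j) + Phi (node n j))"
  proof (intro sum.cong refl)
    fix j assume j: "j \<in> {1..J-1}"
    have "real j * h \<le> real (J - 1) * h" using j h by (intro mult_right_mono) auto
    hence "real j * h \<le> Xend" using le by (rule order_trans)
    hence "integrand (real j * h) = ln (2 * sin (real j * h / 2)) + Phi (2 * sin (real j * h / 2))"
      using j h by (intro integrand_Phi) auto
    moreover have "real j * h / 2 = pi * real j / n" by (simp add: h_def)
    ultimately show "integrand (real j * h) = ln (node n j) + Phi (node n j)" by (simp only:)
  qed
  also have "6 * sqrt h + 6 * sqrt (Xend - real (J - 1) * h) \<le> 6 * sqrt h + 6 * sqrt (4 * delta n + 2 * h)"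
  proof -
    have "angle_upper n (Suc J) = (real J + 1) * h" by (simp add: h_def)
    hence "Xend - real (J - 1) * h \<le> 4 * delta n + 2 * h"
      using P(4) unfolding Jr by (simp add: algebra_simps)
    thus ?thesis by simp
  qed
  finally show ?thesis unfolding J_def h_def by simp
qed

text \<open>The Riemann sum error plus 2 / n times the errors of the sums, with v n + 1 replaced by
  2 (ln n)^2 + 1. The terms with the constant pi / a_max are kept apart in \<open>err_amax\<close>,
  so both functions are explicit in n for \<open>real_asymp\<close>.\<close>

definition err :: "nat \<Rightarrow> real" where
  "err n = (6 * sqrt (2 * pi / n) + 6 * sqrt (4 * delta n + 2 * (2 * pi / n)))
     + 2 / n * ((ln n + 2) * (1 + ln n) + ln n + (2 * (ln n)\<^sup>2 + 1) + 24 * sqrt n + 5 * sqrt n * (1 + ln n))"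

definition err_amax :: "nat \<Rightarrow> real" where
  "err_amax n = 2 / n * (2 * (ln n)\<^sup>2 + 1)"

lemma K_r_bound:
  fixes v :: "nat \<Rightarrow> real"
  assumes "large n" "J_max n \<ge> 2" "0 < v n" "v n \<le> 2 * (ln n)\<^sup>2" "v n \<le> J_max n"
  shows "\<bar>K_r v n - ln Lambda_mu_r\<bar> \<le> err n + pi / a_max * err_amax n"
proof -
  define J where "J = J_max n"
  define m where "m = nat \<lceil>v n\<rceil>"
  define I where "I = integral {0..Xend} integrand"
  have n: "real n \<ge> 100" using assms by (simp add: large_def)
  have m: "1 \<le> m" "m \<le> J_max n" "real m \<le> v n + 1"
    using assms(3,5) by (auto simp: m_def le_nat_iff nat_le_iff ceiling_le_iff)
  define S1 where "S1 = (\<Sum>j=1..J_max n. ln (cmod (zroot n j)))"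
  define S2 where "S2 = (\<Sum>j = 1..nat \<lfloor>v n\<rfloor>. ln (1 + pi / (real n * a_max)))"
  define S3 where "S3 = (\<Sum>j = m..J_max n. ln (1 + pi / (real n * a_coef n j)))"
  define T1 where "T1 = (\<Sum>j=1..J_max n - 1. ln (node n j))"
  define T3 where "T3 = (\<Sum>j=1..J_max n - 1. Phi (node n j))"
  have K: "K_r v n = - 2 * S1 - 2 * S2 - 2 * S3" by (simp add: K_r_def S1_def S2_def S3_def m_def)
  have L: "ln Lambda_mu_r = - 1 / pi * I"
    unfolding Lambda_mu_r_def I_def Xend_def integrand_def by simp
  have 1: "\<bar>n * S1 - T1\<bar> \<le> (ln n + 2) * (1 + ln n) + ln n"
    using first_sum_bound[OF assms(1)] by (simp add: S1_def T1_def)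
  have 3: "\<bar>n * S3 - T3\<bar> \<le> m + 24 * sqrt n + 5 * sqrt n * (1 + ln n) + pi / a_max"
    using second_sum_bound[OF assms(1) m(1,2)] by (simp add: S3_def T3_def)
  have 2: "0 \<le> n * S2 \<and> n * S2 \<le> v n * (pi / a_max)"
  proof -
    have p: "pi / (n * a_max) \<ge> 0" using a_max_kappa n by (intro divide_nonneg_nonneg) auto
    have "n * ln (1 + pi / (n * a_max)) \<le> n * (pi / (n * a_max))"
      using p by (intro mult_left_mono ln_add_one_self_le_self) auto
    also have "\<dots> = pi / a_max" using n by simp
    finally have q: "n * ln (1 + pi / (n * a_max)) \<le> pi / a_max" .
    have f: "real (nat \<lfloor>v n\<rfloor>) \<le> v n" using assms(3) by linarith
    have S2: "n * S2 = real (nat \<lfloor>v n\<rfloor>) * (n * ln (1 + pi / (n * a_max)))" by (simp add: S2_def)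
    have "real (nat \<lfloor>v n\<rfloor>) * (n * ln (1 + pi / (n * a_max))) \<le> v n * (pi / a_max)"
      using f q p n assms(3) by (intro mult_mono) auto
    thus ?thesis unfolding S2 using p n by auto
  qed
  have 4: "\<bar>2 * pi / n * (T1 + T3) - I\<bar> \<le> 6 * sqrt (2 * pi / n) + 6 * sqrt (4 * delta n + 2 * (2 * pi / n))"
    using riemann_bound[OF assms(1,2)] by (simp add: T1_def T3_def I_def sum.distrib)
  define E4 where "E4 = 6 * sqrt (2 * pi / n) + 6 * sqrt (4 * delta n + 2 * (2 * pi / n))"
  define c where "c = pi / a_max"
  have c: "c \<ge> 0" using a_max_kappa by (simp add: c_def)
  define W where "W = (ln n + 2) * (1 + ln n) + ln n + (2 * (ln n)\<^sup>2 + 1) + 24 * sqrt n + 5 * sqrt n * (1 + ln n)"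
  \<comment> \<open>Each sum is compared after multiplication by n; the weight 2 / n in front is 1 /
    pi times the mesh 2 pi / n.\<close>
  have "K_r v n - ln Lambda_mu_r = - (1 / pi) * (2 * pi / n * (T1 + T3) - I)
      + 2 / n * ((T1 - n * S1) + (T3 - n * S3) - n * S2)"
    unfolding K L using n by (simp add: field_simps)
  also have "\<bar>\<dots>\<bar> \<le> \<bar>- (1 / pi) * (2 * pi / n * (T1 + T3) - I)\<bar>
      + \<bar>2 / n * ((T1 - n * S1) + (T3 - n * S3) - n * S2)\<bar>" by (rule abs_triangle_ineq)
  also have "\<dots> \<le> E4 + 2 / n * (W + c * (2 * (ln n)\<^sup>2 + 1))"
  proof (rule add_mono)
    have "\<bar>- (1 / pi) * (2 * pi / n * (T1 + T3) - I)\<bar> = 1 / pi * \<bar>2 * pi / n * (T1 + T3) - I\<bar>"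
      by (simp add: abs_mult)
    also have "\<dots> \<le> 1 * E4" using 4 pi_gt3 unfolding E4_def[symmetric] by (intro mult_mono) auto
    finally show "\<bar>- (1 / pi) * (2 * pi / n * (T1 + T3) - I)\<bar> \<le> E4" by simp
    have "v n * c \<le> 2 * (ln n)\<^sup>2 * c" using assms(4) c by (intro mult_right_mono)
    hence "\<bar>(T1 - n * S1) + (T3 - n * S3) - n * S2\<bar> \<le> W + c * (2 * (ln n)\<^sup>2 + 1)"
      using 1 2 3 m(3) assms(4) unfolding c_def[symmetric] W_def abs_le_iff
      by (simp add: mult.commute[of _ c] distrib_left[of c])
    hence "2 / n * \<bar>(T1 - n * S1) + (T3 - n * S3) - n * S2\<bar> \<le> 2 / n * (W + c * (2 * (ln n)\<^sup>2 + 1))"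
      by (intro mult_left_mono) auto
    thus "\<bar>2 / n * ((T1 - n * S1) + (T3 - n * S3) - n * S2)\<bar> \<le> 2 / n * (W + c * (2 * (ln n)\<^sup>2 + 1))"
      unfolding abs_mult by simp
  qed
  also have "\<dots> = err n + c * err_amax n"
    unfolding err_def err_amax_def E4_def[symmetric] W_def[symmetric]
    by (simp add: distrib_left mult.commute mult.left_commute)
  finally show ?thesis by (simp only: c_def)
qed

definition rate :: "nat \<Rightarrow> real" where
  "rate n = (ln (ln n) / ln n)\<^sup>2"

lemma err_bigo: "err \<in> O(rate)" "err_amax \<in> O(rate)" "(\<lambda>n. 2 / sqrt (real n - 1)) \<in> O(rate)"
  unfolding err_def err_amax_def rate_def delta_def by real_asymp+

lemma eventually_large: "eventually large sequentially"
proof -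
  have "\<forall>\<^sub>F n in sequentially. 2 * pi / real n + 2 * delta n \<le> 17 / 100"
    unfolding delta_def by real_asymp
  thus ?thesis unfolding large_def using eventually_ge_at_top[of 100] by eventually_elim auto
qed

lemma Xend_ge: "17 / 100 \<le> Xend"
  using Xend_bounds kappa_bounds sin_x_le_x[of "Xend / 2"] by linarith

text \<open>With epsilon < 1 the bound on v n - u n gives v n <= 2 (ln n)^2, whereas
  \<open>J_max n\<close> grows linearly in n; so the cut at v n eventually falls below
  \<open>J_max n\<close>.\<close>

lemma eventually_K_r_bound:
  assumes "admissible \<epsilon> u v" "\<epsilon> < 1"
  shows "\<forall>\<^sub>F n in sequentially. \<bar>K_r v n - ln Lambda_mu_r\<bar> \<le> err n + pi / a_max * err_amax n"
proof -
  have ev: "\<forall>\<^sub>F n in sequentially. 2 * (ln n)\<^sup>2 + 2 \<le> real n / (2 * pi) * (17 / 100 - 4 * delta n) - 1"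
    unfolding delta_def by real_asymp
  show ?thesis
    using eventually_large ev eventually_ge_at_top[of 18]
  proof eventually_elim
    case (elim n)
    have n: "real n \<ge> 100" using elim by (simp add: large_def)
    have l1: "ln (real n) \<ge> 1" using n exp_le by (subst ln_ge_iff) auto
    have v: "ln (real n) < v n" "u n < ln (real n)" "v n - u n \<le> ln (real n) powr (1 + \<epsilon>)"
      using assms(1) elim(3) by (auto simp: admissible_def)
    have "ln (real n) powr (1 + \<epsilon>) \<le> ln (real n) powr 2" using l1 assms(2) by (intro powr_mono) auto
    also have "\<dots> = (ln (real n))\<^sup>2" using l1 by (simp add: powr_numeral)
    finally have "v n \<le> (ln (real n))\<^sup>2 + ln (real n)" using v by linarith
    moreover have "ln (real n) * 1 \<le> ln (real n) * ln (real n)" using l1 by (intro mult_left_mono) auto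
    ultimately have v2: "v n \<le> 2 * (ln (real n))\<^sup>2" by (simp add: power2_eq_square)
    have J: "2 * (ln n)\<^sup>2 + 2 \<le> J_max n"
    proof -
      have "17 / 100 - 4 * delta n \<le> angle_upper n (Suc (J_max n))"
        using J_max_props(4)[OF elim(1)] Xend_ge by linarith
      hence "real n / (2 * pi) * (17 / 100 - 4 * delta n) \<le> real n / (2 * pi) * angle_upper n (Suc (J_max n))"
        by (intro mult_left_mono) auto
      also have "\<dots> = real (Suc (J_max n))" using n by simp
      finally show ?thesis using elim(2) by simp
    qed
    have "2 \<le> J_max n" using J zero_le_power2[of "ln (real n)"] by linarith
    thus ?case using elim(1) v v2 l1 J by (intro K_r_bound) auto
  qed
qed

theorem theorem6p3:
  shows "\<exists>\<epsilon>\<^sub>0. 0 < \<epsilon>\<^sub>0 \<and> \<epsilon>\<^sub>0 \<le> 1 \<and>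
    (\<forall>\<epsilon> u v. 0 < \<epsilon> \<and> \<epsilon> < \<epsilon>\<^sub>0 \<and> admissible \<epsilon> u v \<longrightarrow>
      (\<exists>(R :: real \<Rightarrow> nat \<Rightarrow> real) (C :: real). \<forall>(\<alpha> :: complex) (n :: nat).
         algebraic_int \<alpha> \<and> reciprocal \<alpha> \<and> house \<alpha> > 1 \<and>
         n = dyg (house \<alpha>) \<and> n \<ge> 260 \<and>
         mahler_measure (min_int_poly \<alpha>) < lehmer_number \<and>
         \<not> (\<exists>(r :: nat) (Q :: int poly). r \<ge> 2 \<and> min_int_poly \<alpha> = pcompose Q (Polynomial.monom 1 r))
         \<longrightarrow>
         \<bar>R (house \<alpha>) n\<bar> < arcsin (kappa / 2) / pi \<and>
         \<bar>L_r v \<alpha> - (ln Lambda_mu_r + R (house \<alpha>) n / ln (real n))\<bar>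
           \<le> C * (ln (ln (real n)) / ln (real n))\<^sup>2))"
proof (rule exI[of _ 1], intro conjI allI impI)
  fix \<epsilon> :: real and u v :: "nat \<Rightarrow> real"
  assume "0 < \<epsilon> \<and> \<epsilon> < 1 \<and> admissible \<epsilon> u v"
  hence adm: "admissible \<epsilon> u v" "\<epsilon> < 1" by auto
  define E where "E = (\<lambda>n. err n + pi / a_max * err_amax n + 2 / sqrt (real n - 1))"
  have "(\<lambda>n. pi / a_max * err_amax n) \<in> O(rate)"
    using err_bigo(2) a_max_kappa(1) by (subst landau_o.big.cmult_in_iff) auto
  hence "E \<in> O(rate)" unfolding E_def by (intro sum_in_bigo err_bigo)
  then obtain C0 where "\<forall>\<^sub>F n in sequentially. norm (E n) \<le> C0 * norm (rate n)"
    by (auto elim!: landau_o.bigE)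
  with eventually_K_r_bound[OF adm]
  have "\<forall>\<^sub>F n in sequentially. \<bar>K_r v n - ln Lambda_mu_r\<bar> + 2 / sqrt (real n - 1) \<le> C0 * rate n"
    by eventually_elim (auto simp: E_def rate_def)
  then obtain N where N: "\<bar>K_r v n - ln Lambda_mu_r\<bar> + 2 / sqrt (real n - 1) \<le> C0 * rate n" if "n \<ge> N" for n
    by (auto simp: eventually_at_top_linorder)
  \<comment> \<open>The finitely many n from 260 to N - 1 are absorbed by adding their ratios to the
    constant; this is possible because \<open>rate n\<close> is positive there.\<close>
  define Z where "Z = (\<lambda>n. (\<bar>K_r v n - ln Lambda_mu_r\<bar> + 2 / sqrt (real n - 1)) / rate n)"
  define C where "C = \<bar>C0\<bar> + (\<Sum>n=260..<N. Z n)"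
  have rate: "rate n > 0" if "n \<ge> 260" for n
  proof -
    have "exp 1 < real n" using exp_le that by linarith
    hence "ln (exp 1) < ln (real n)" using that by (subst ln_less_cancel_iff) auto
    hence "1 < ln (real n)" by simp
    thus ?thesis by (simp add: rate_def)
  qed
  have Z: "Z n \<ge> 0" if "n \<ge> 260" for n
    using rate[OF that] that by (auto simp: Z_def intro!: divide_nonneg_pos add_nonneg_nonneg)
  have C: "\<bar>K_r v n - ln Lambda_mu_r\<bar> + 2 / sqrt (real n - 1) \<le> C * rate n" if n: "n \<ge> 260" for n
  proof (cases "n \<ge> N")
    case True
    have "C0 \<le> C" using Z by (auto simp: C_def intro!: add_increasing2 sum_nonneg)
    hence "C0 * rate n \<le> C * rate n" using rate[OF n] by (intro mult_right_mono) auto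
    thus ?thesis using N[OF True] by linarith
  next
    case False
    have "Z n \<le> (\<Sum>n=260..<N. Z n)" using False n Z by (intro member_le_sum) auto
    hence "Z n * rate n \<le> C * rate n" using rate[OF n] by (intro mult_right_mono) (auto simp: C_def)
    thus ?thesis using rate[OF n] by (simp add: Z_def)
  qed
  show "\<exists>(R :: real \<Rightarrow> nat \<Rightarrow> real) (C :: real). \<forall>(\<alpha> :: complex) (n :: nat).
         algebraic_int \<alpha> \<and> reciprocal \<alpha> \<and> house \<alpha> > 1 \<and>
         n = dyg (house \<alpha>) \<and> n \<ge> 260 \<and>
         mahler_measure (min_int_poly \<alpha>) < lehmer_number \<and>
         \<not> (\<exists>(r :: nat) (Q :: int poly). r \<ge> 2 \<and> min_int_poly \<alpha> = pcompose Q (Polynomial.monom 1 r))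
         \<longrightarrow>
         \<bar>R (house \<alpha>) n\<bar> < arcsin (kappa / 2) / pi \<and>
         \<bar>L_r v \<alpha> - (ln Lambda_mu_r + R (house \<alpha>) n / ln (real n))\<bar>
           \<le> C * (ln (ln (real n)) / ln (real n))\<^sup>2"
  proof (rule exI[of _ "\<lambda>_ _. 0"], rule exI[of _ C], intro allI impI, elim conjE)
    fix \<alpha> :: complex and n :: nat
    assume a: "algebraic_int \<alpha>" "house \<alpha> > 1" "n = dyg (house \<alpha>)" "n \<ge> 260"
      "mahler_measure (min_int_poly \<alpha>) < lehmer_number"
    \<comment> \<open>The bound by Lehmer's number enters here: it keeps the house below the golden
      ratio.\<close>
    have h: "house \<alpha> < 3 / 2"
      using house_le_mahler_measure[OF a(1,2)] a(5) lehmer_number_less by linarith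
    have "0 \<le> ln (house \<alpha>)" "ln (house \<alpha>) \<le> 2 / sqrt (real (n - 1))"
      using ln_house_bound[OF a(2) h a(3)] a(4) by auto
    moreover have "real (n - 1) = real n - 1" using a(4) by simp
    ultimately have "\<bar>L_r v \<alpha> - ln Lambda_mu_r\<bar> \<le> C * rate n"
      using C[OF a(4)] unfolding L_r_eq a(3)[symmetric] by simp
    moreover have "0 < arcsin (kappa / 2)" using Xend_bounds(1) by (simp add: Xend_def)
    ultimately show "\<bar>0\<bar> < arcsin (kappa / 2) / pi \<and>
         \<bar>L_r v \<alpha> - (ln Lambda_mu_r + 0 / ln (real n))\<bar> \<le> C * (ln (ln (real n)) / ln (real n))\<^sup>2"
      by (simp add: rate_def)
  qed
qed auto

end
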